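(* Let $N\ge2$ be fixed and $T>0$. For $\beta\ge1$ let $\lambda_1^{(\beta)}(t)\le\cdots\le\lambda_N^{(\beta)}(t)$ be the unique strong solution of $$d\lambda_i(t)=\sqrt{\tfrac{2}{\beta}}\,db_i(t)+\sum_{j:\,j\ne i}\frac{1}{\lambda_i(t)-\lambda_j(t)}\,dt,\qquad \lambda_i(0)=0,\quad i=1,\dots,N,$$ with $\lambda_1(t)\le\cdots\le\lambda_N(t)$ almost surely, where $b_1,\dots,b_N$ are independent standard Brownian motions, and let $\mu_t^{(\beta)}=\frac1N\sum_{i=1}^N\delta_{\lambda_i^{(\beta)}(t)}$ be the empirical measure process. Let $$\mu_t=\frac1N\sum_{i=1}^N\delta_{\sqrt t\,z_{i,N}^{(H)}},$$ where $z_{1,N}^{(H)}<\dots<z_{N,N}^{(H)}$ are the zeros of the $N$th probabilist's Hermite polynomial $H_N$. Then, as $\beta\to\infty$: (1) the probability-measure-valued process $(\mu_t^{(\beta)})_{t\in[0,T]}$ converges to $(\mu_t)_{t\in[0,T]}$ in probability, under the topology of uniform convergence on $[0,T]$; (2) for every polynomial $f(t,x)$ in $t$ and $x$, $\langle\mu_t^{(\beta)},f\rangle$ converges to $\langle\mu_t,f\rangle$ in probability uniformly on $[0,T]$, i.e. $\lim_{\beta\to\infty}\mathbb P(\sup_{0\le t\le T}|\langle\mu_t^{(\beta)},f\rangle-\langle\mu_t,f\rangle|\ge\varepsilon)=0$ for every $\varepsilon>0$; (3) for every polynomial $f(t,x)$ in $t$ and $x$, $\langle\mu_t,f\rangle$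 is differentiable as a function of $t$ and $$\partial_t\langle\mu_t,f\rangle=\frac N2\iint\frac{f'(t,x)-f'(t,y)}{x-y}\,d\mu_t(x)\,d\mu_t(y)+\Big\langle\mu_t,-\tfrac12 f''+\partial_t f\Big\rangle .$$
   Context: For a function $f(t,x)$, $\partial_t f=\partial f/\partial t$, $f'=\partial f/\partial x$, $f''=\partial^2 f/\partial x^2$, and $\langle\mu,f\rangle=\int f(t,x)\,d\mu(x)$ (integration over $x$ only). The quotient $\frac{f'(t,x)-f'(t,y)}{x-y}$ is understood as $f''(t,x)$ when $x=y$. $\partial_t\langle\mu_t,f\rangle$ denotes the (total) derivative in $t$ of the function $t\mapsto\langle\mu_t,f(t,\cdot)\rangle$. The space of probability measures on $\mathbb R$ carries the topology of weak convergence (metrized by a metric compatible with it), and measure-valued continuous processes on $[0,T]$ carry the corresponding topology of uniform convergence. The probabilist's Hermite polynomials are $H_0=1$, $H_1=x$, $H_{n+1}=xH_n-nH_{n-1}$. It is known that the system of SDEs has a unique strong solution and that for $\beta\ge 1$ the $\lambda_i^{(\beta)}(t)$ are almost surely distinct for all $t>0$. *)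

theory Defs
  imports "HOL-Probability.Probability" "HOL-Computational_Algebra.Polynomial"
begin

section \<open>Brownian motions and the Dyson system\<close>

definition std_brownian_motion :: "'a measure \<Rightarrow> (real \<Rightarrow> 'a \<Rightarrow> real) \<Rightarrow> bool" where
  "std_brownian_motion M b \<longleftrightarrow>
     (\<forall>t\<ge>0. b t \<in> borel_measurable M) \<and>
     (AE \<omega> in M. b 0 \<omega> = 0) \<and>
     (\<forall>s t. 0 \<le> s \<longrightarrow> s < t \<longrightarrow>
        distributed M lborel (\<lambda>\<omega>. b t \<omega> - b s \<omega>) (normal_density 0 (sqrt (t - s)))) \<and>
     (\<forall>(n::nat) \<tau>. 0 \<le> \<tau> 0 \<longrightarrow> strict_mono_on {..n} \<tau> \<longrightarrow>
        prob_space.indep_vars M (\<lambda>_. borel) (\<lambda>k \<omega>. b (\<tau> (Suc k)) \<omega> - b (\<tau> k) \<omega>) {..<n}) \<and>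
     (AE \<omega> in M. continuous_on {0..} (\<lambda>t. b t \<omega>))"

definition independent_brownian_motions ::
    "'a measure \<Rightarrow> nat \<Rightarrow> (nat \<Rightarrow> real \<Rightarrow> 'a \<Rightarrow> real) \<Rightarrow> bool" where
  "independent_brownian_motions M N b \<longleftrightarrow>
     (\<forall>i\<in>{1..N}. std_brownian_motion M (b i)) \<and>
     prob_space.indep_vars M (\<lambda>_. PiM {0..} (\<lambda>_. borel))
       (\<lambda>i \<omega>. \<lambda>t\<in>{0..}. b i t \<omega>) {1..N}"

text \<open>The filtration generated by the driving noise, augmented by the null sets of the completed
  measure (all subsets of events of probability zero).\<close>

definition brownian_filtration ::
    "'a measure \<Rightarrow> nat \<Rightarrow> (nat \<Rightarrow> real \<Rightarrow> 'a \<Rightarrow> real) \<Rightarrow> real \<Rightarrow> 'a measure" where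
  "brownian_filtration M N b t =
     sigma (space M)
       ({b i s -` A \<inter> space M | i s A. i \<in> {1..N} \<and> 0 \<le> s \<and> s \<le> t \<and> A \<in> sets borel}
        \<union> null_sets (completion M))"

definition dyson_drift :: "nat \<Rightarrow> (nat \<Rightarrow> real) \<Rightarrow> nat \<Rightarrow> real" where
  "dyson_drift N x i = (\<Sum>j\<in>{1..N} - {i}. 1 / (x i - x j))"

text \<open>Strong solution, on the given probability space and for the given Brownian motions, of
  \<open>dX\<^sub>i = sqrt (2 / \<beta>) db\<^sub>i + (\<Sum>j\<noteq>i. 1 / (X\<^sub>i - X\<^sub>j)) dt\<close>, \<open>X\<^sub>i(0) = 0\<close>, in the ordered regime.
  As the diffusion coefficient is constant and \<open>b\<^sub>i(0) = 0\<close>, the stochastic integral is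
  \<open>sqrt (2 / \<beta>) b\<^sub>i(t)\<close>.
  Since \<open>1 / 0 = 0\<close> in HOL, the condition that the particles are distinct at Lebesgue-almost every
  time is what makes the drift term carry its intended meaning; it does not exclude
  collisions at exceptional times (such as time 0).\<close>

definition dyson_strong_solution ::
    "'a measure \<Rightarrow> nat \<Rightarrow> (nat \<Rightarrow> real \<Rightarrow> 'a \<Rightarrow> real) \<Rightarrow> real \<Rightarrow> (nat \<Rightarrow> real \<Rightarrow> 'a \<Rightarrow> real) \<Rightarrow> bool" where
  "dyson_strong_solution M N b \<beta> X \<longleftrightarrow>
     (\<forall>i\<in>{1..N}. \<forall>t\<ge>0. X i t \<in> borel_measurable (brownian_filtration M N b t)) \<and>
     (\<forall>i\<in>{1..N}. AE \<omega> in M. continuous_on {0..} (\<lambda>t. X i t \<omega>)) \<and>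
     (\<forall>i\<in>{1..N}. AE \<omega> in M. X i 0 \<omega> = 0) \<and>
     (AE \<omega> in M. \<forall>t\<ge>0. mono_on {1..N} (\<lambda>i. X i t \<omega>)) \<and>
     (AE \<omega> in M. AE s in lborel. 0 \<le> s \<longrightarrow> inj_on (\<lambda>i. X i s \<omega>) {1..N}) \<and>
     (\<forall>i\<in>{1..N}. AE \<omega> in M. \<forall>t\<ge>0.
        set_integrable lborel {0..t} (\<lambda>s. dyson_drift N (\<lambda>k. X k s \<omega>) i) \<and>
        X i t \<omega> = X i 0 \<omega> + sqrt (2 / \<beta>) * b i t \<omega>
                  + (LINT s:{0..t}|lborel. dyson_drift N (\<lambda>k. X k s \<omega>) i))"


section \<open>Empirical measures and Hermite polynomials\<close>

definition empirical_measure :: "nat \<Rightarrow> (nat \<Rightarrow> real) \<Rightarrow> real measure" where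
  "empirical_measure N x =
     measure_of UNIV (sets borel) (\<lambda>A. (\<Sum>i=1..N. emeasure (return borel (x i)) A) / of_nat N)"

lemma sets_empirical_measure [simp, measurable_cong]: "sets (empirical_measure N x) = sets borel"
  unfolding empirical_measure_def
  by (metis sets.sigma_sets_eq sets_measure_of space_borel sets.space_closed)

lemma space_empirical_measure [simp]: "space (empirical_measure N x) = UNIV"
  by (simp add: empirical_measure_def)

lemma emeasure_empirical_measure:
  assumes "A \<in> sets borel"
  shows "emeasure (empirical_measure N x) A
           = (\<Sum>i=1..N. emeasure (return borel (x i)) A) / of_nat N"
proof -
  let ?m = "\<lambda>A. (\<Sum>i=1..N. emeasure (return borel (x i)) A) / of_nat N :: ennreal"
  have "countably_additive (sets borel) ?m"
  proof (rule countably_additiveI)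
    fix F :: "nat \<Rightarrow> real set"
    assume F: "range F \<subseteq> sets borel" "disjoint_family F" "\<Union> (range F) \<in> sets borel"
    have "(\<Sum>k. emeasure (return borel (x i)) (F k)) = emeasure (return borel (x i)) (\<Union> (range F))"
      for i
      using F by (intro suminf_emeasure) auto
    then show "(\<Sum>k. ?m (F k)) = ?m (\<Union> (range F))"
      by (simp add: divide_ennreal_def ennreal_suminf_multc suminf_sum)
  qed
  moreover have "positive (sets borel) ?m"
    by (simp add: positive_def divide_ennreal_def)
  ultimately show ?thesis
    using assms sets.sigma_algebra_axioms[of "borel :: real measure"]
    unfolding empirical_measure_def
    by (intro emeasure_measure_of_sigma) (auto simp: space_borel)
qed

fun hermite :: "nat \<Rightarrow> real poly" where
  "hermite 0 = 1"
| "hermite (Suc 0) = [:0, 1:]"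
| "hermite (Suc (Suc n)) = [:0, 1:] * hermite (Suc n) - of_nat (Suc n) * hermite n"


section \<open>Weak topology and uniform convergence in probability\<close>

text \<open>Its underlying set is the set of all Borel probability measures on the real line
  (choose \<open>f = 0\<close> and \<open>U = UNIV\<close>).\<close>

definition weak_topology :: "real measure topology" where
  "weak_topology = topology_generated_by
     {{\<mu>. real_distribution \<mu> \<and> (\<integral>x. f x \<partial>\<mu>) \<in> U} | (f :: real \<Rightarrow> real) U.
        continuous_on UNIV f \<and> bounded (range f) \<and> open U}"

text \<open>\<open>e \<beta> t \<omega> \<ge> 0\<close> is the discrepancy at time \<open>t\<close> between the process with parameter \<open>\<beta>\<close> and its
  limit; \<open>sup\<^bsub>0\<le>t\<le>T\<^esub> e \<beta> t\<close> has to tend to 0 in probability.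
  Paths are continuous only almost surely, so the events live in the completed
  probability space. Their measurability is demanded explicitly, because the measure of a
  non-measurable set is 0 in HOL. The supremum is extended-real so that it is meaningful
  for unbounded paths too.\<close>

definition uniformly_vanishes_in_prob ::
    "'a measure \<Rightarrow> real \<Rightarrow> (real \<Rightarrow> real \<Rightarrow> 'a \<Rightarrow> real) \<Rightarrow> bool" where
  "uniformly_vanishes_in_prob M T e \<longleftrightarrow>
     (\<forall>\<epsilon>>0.
        (\<forall>\<beta>\<ge>1. {\<omega> \<in> space M. (SUP t\<in>{0..T}. ereal (e \<beta> t \<omega>)) \<ge> ereal \<epsilon>} \<in> sets (completion M)) \<and>
        ((\<lambda>\<beta>. measure (completion M)
               {\<omega> \<in> space M. (SUP t\<in>{0..T}. ereal (e \<beta> t \<omega>)) \<ge> ereal \<epsilon>}) \<longlongrightarrow> 0) at_top)"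


section \<open>Polynomials in two variables\<close>

definition polynomial_function2 :: "(real \<Rightarrow> real \<Rightarrow> real) \<Rightarrow> bool" where
  "polynomial_function2 f \<longleftrightarrow>
     (\<exists>(n::nat) (c :: nat \<Rightarrow> nat \<Rightarrow> real). \<forall>t x. f t x = (\<Sum>i\<le>n. \<Sum>j\<le>n. c i j * t ^ i * x ^ j))"

definition deriv_quotient :: "(real \<Rightarrow> real \<Rightarrow> real) \<Rightarrow> real \<Rightarrow> real \<Rightarrow> real \<Rightarrow> real" where
  "deriv_quotient f t x y =
     (if x = y then deriv (deriv (f t)) x else (deriv (f t) x - deriv (f t) y) / (x - y))"

end

theory Submission
  imports Defs
begin

text \<open>
  The comparison is pathwise. Let \<open>X\<close> solve the system with noise \<open>w = sqrt (2/\<beta>) b\<close>, let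
  \<open>Y\<^sub>i(t) = sqrt t z\<^sub>i\<close>, which by Stieltjes' relation
  \<open>z\<^sub>i / 2 = (\<Sum>j\<noteq>i. 1 / (z\<^sub>i - z\<^sub>j))\<close> solves it without noise, and put \<open>V = X - w - Y\<close>. The drift is
  monotone on the ordered chamber, so \<open>d|V|\<^sup>2/dt\<close> is at most \<open>2 sup|w|\<close> times the sum of the absolute
  values of both drifts. That sum is in turn dominated by the linear functional
  \<open>2 (\<Sum>i. i * drift\<^sub>i)\<close>, whose time integral is explicit in \<open>V\<close> and \<open>Y\<close>. This
  yields \<open>|V|\<^sup>2 \<le> C (sup|w| + (sup|w|)\<^sup>2)\<close>, and \<open>sup|w|\<close> tends to 0 in probability merely because Brownian
  paths are continuous.\<close>

section \<open>Monotonicity and coercivity of the drift\<close>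

text \<open>A Lipschitz comparison of \<open>X\<close> and \<open>Y\<close> is impossible: the drift
  is unbounded near collisions, and at time 0 all particles of both systems coincide. What remains
  usable is the sign of drift differences and the time integral of the drift. The noise is
  subtracted because \<open>V\<close> is then the integral of an integrable function, so
  \<open>|V|^2\<close> obeys ordinary calculus although the noise is rough. The price is that
  monotonicity speaks about \<open>X - Y = V + w\<close> instead of \<open>V\<close>; the error is
  \<open>w\<close> times a difference of drifts, and this is why the drift has to be controlled in
  L1 over time.

  From particles to measures: the discrepancies in (1) and (2) are both of the form
  \<open>G t x\<close> with \<open>G\<close> jointly continuous, depending only on finitely many
  coordinates and zero along \<open>Y\<close>, so one theorem about such \<open>G\<close> serves
  both. Since (1) allows every metric inducing the weak topology, only continuity of
  \<open>G\<close> can be used, and compactness of the time interval has to supply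
  uniformity.\<close>

text \<open>Since \<open>1 / 0 = 0\<close>, the diagonal term vanishes and sums may run over all pairs.\<close>

lemma dyson_drift_eq: "dyson_drift N x i = (\<Sum>j=1..N. 1 / (x i - x j))"
  unfolding dyson_drift_def by (rule sum.mono_neutral_left) auto

text \<open>Symmetrisation: exchange \<open>i\<close> and \<open>j\<close> and average. In this
  pairwise form the singular kernel meets only differences \<open>a i - a j\<close>, which carry the
  sign or the cancellation that each later use exploits.\<close>

lemma sum_dyson_drift:
  "(\<Sum>i=1..N. a i * dyson_drift N x i) = (\<Sum>i=1..N. \<Sum>j=1..N. (a i - a j) / (x i - x j)) / 2"
proof -
  have "(\<Sum>i=1..N. a i * dyson_drift N x i) = (\<Sum>i=1..N. \<Sum>j=1..N. a i / (x i - x j))"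
    by (simp add: dyson_drift_eq sum_distrib_left)
  moreover have "(\<Sum>i=1..N. \<Sum>j=1..N. a i / (x i - x j)) = (\<Sum>i=1..N. \<Sum>j=1..N. a j / (x j - x i))"
    by (rule sum.swap)
  moreover have "(a i - a j) / (x i - x j) = a i / (x i - x j) + a j / (x j - x i)" for i j
    by (metis diff_divide_distrib minus_diff_eq minus_divide_right uminus_add_conv_diff add.commute)
  ultimately show ?thesis
    by (simp add: sum.distrib)
qed

text \<open>On the ordered chamber the drift is the gradient of the concave function
  \<open>\<Sum>i<j. ln (x j - x i)\<close>. Pairwise, with \<open>u = x i - x j\<close> and
  \<open>v = y i - y j\<close> of equal sign, this is
  \<open>(u - v) * (1/u - 1/v) = - (u - v)^2 / (u * v)\<close>.\<close>

lemma dyson_drift_monotone: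
  assumes x: "strict_mono_on {1..N} x" and y: "strict_mono_on {1..N} y"
  shows "(\<Sum>i=1..N. (x i - y i) * (dyson_drift N x i - dyson_drift N y i)) \<le> 0"
proof -
  let ?a = "\<lambda>i. x i - y i"
  have "(?a i - ?a j) / (x i - x j) \<le> (?a i - ?a j) / (y i - y j)"
    if ij: "i \<in> {1..N}" "j \<in> {1..N}" for i j
  proof -
    have *: "(u - v) / u \<le> (u - v) / v" if "u * v > 0" for u v :: real
    proof -
      have "(u - v) / v - (u - v) / u = (u - v)\<^sup>2 / (u * v)"
        using that by (cases "u = 0"; cases "v = 0") (auto simp: field_simps power2_eq_square)
      then show ?thesis using that by (smt (verit) divide_nonneg_pos zero_le_power2)
    qed
    consider "i = j" | "i < j" | "j < i" by linarith
    then have "i = j \<or> (x i - x j) * (y i - y j) > 0"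
      using ij strict_mono_onD[OF x] strict_mono_onD[OF y]
      by cases (auto intro: mult_pos_pos mult_neg_neg)
    then show ?thesis
      using *[of "x i - x j" "y i - y j"] by (auto simp: algebra_simps)
  qed
  then have "(\<Sum>i=1..N. \<Sum>j=1..N. (?a i - ?a j) / (x i - x j))
           \<le> (\<Sum>i=1..N. \<Sum>j=1..N. (?a i - ?a j) / (y i - y j))"
    by (intro sum_mono) auto
  then show ?thesis
    using sum_dyson_drift[of ?a N x] sum_dyson_drift[of ?a N y]
    by (simp add: right_diff_distrib sum_subtractf)
qed

text \<open>The right-hand side is linear in the drift, so its time integral only involves end points.\<close>

lemma sum_abs_dyson_drift_le:
  assumes x: "strict_mono_on {1..N} x"
  shows "(\<Sum>i=1..N. \<bar>dyson_drift N x i\<bar>) \<le> 2 * (\<Sum>i=1..N. real i * dyson_drift N x i)"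
proof -
  have "\<bar>dyson_drift N x i\<bar> \<le> (\<Sum>j=1..N. (real i - real j) / (x i - x j))"
    if i: "i \<in> {1..N}" for i
  proof -
    \<comment> \<open>The weights \<open>i\<close> increase along the order of the particles, so the
      quotient is nonnegative, and distinct indices differ by at least 1. The factor 2 in the claim
      cancels the half from symmetrisation.\<close>
    have "\<bar>1 / (x i - x j)\<bar> \<le> (real i - real j) / (x i - x j)" if j: "j \<in> {1..N}" for j
    proof -
      consider "i = j" | "i < j" | "j < i" by linarith
      then show ?thesis
      proof cases
        case 2
        then have "x i < x j" using i j strict_mono_onD[OF x] by blast
        then have "\<bar>1 / (x i - x j)\<bar> = 1 / (x j - x i)" by simp
        also have "\<dots> \<le> (real j - real i) / (x j - x i)"
          using 2 \<open>x i < x j\<close> by (intro divide_right_mono) auto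
        finally show ?thesis by (metis minus_diff_eq minus_divide_divide)
      next
        case 3
        then have "x j < x i" using i j strict_mono_onD[OF x] by blast
        then show ?thesis using 3 by (auto intro: divide_right_mono)
      qed auto
    qed
    then show ?thesis
      unfolding dyson_drift_eq by (intro order.trans[OF sum_abs] sum_mono) auto
  qed
  then show ?thesis
    unfolding sum_dyson_drift by (auto intro!: sum_mono)
qed

text \<open>Fubini's theorem on the two triangles of the square replaces the chain rule, as \<open>G\<close> is only
  absolutely continuous.\<close>

lemma set_lborel_integral_square:
  fixes g :: "real \<Rightarrow> real"
  assumes g: "set_integrable lborel {0..t} g"
  defines "G \<equiv> \<lambda>s. LINT r:{0..s}|lborel. g r"
  shows "set_integrable lborel {0..t} (\<lambda>s. G s * g s)"
    and "(G t)\<^sup>2 = 2 * (LINT s:{0..t}|lborel. G s * g s)"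
proof -
  define h where "h = (\<lambda>s. indicat_real {0..t} s * g s)"
  \<comment> \<open>\<open>k\<close> is \<open>h s * h r\<close> restricted to the triangle
    \<open>r \<le> s\<close>. Integrating over \<open>r\<close> first gives
    \<open>G s * h s\<close>.\<close>
  define k where "k = (\<lambda>s r. indicat_real {..s} r * (h s * h r))"
  have h: "integrable lborel h"
    using g unfolding h_def set_integrable_def by simp
  then have [measurable]: "h \<in> borel_measurable lborel" by auto
  have GG: "G s = (LINT r|lborel. indicat_real {..s} r * h r)" if "s \<le> t" for s
    unfolding G_def set_lebesgue_integral_def h_def using that
    by (intro Bochner_Integration.integral_cong) (auto simp: indicator_def)
  have hh: "integrable (lborel \<Otimes>\<^sub>M lborel) (\<lambda>(s, r). h s * h r)"
    by (rule lborel_pair.Fubini_integrable)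
       (use h in \<open>auto simp: abs_mult intro!: integrable_mult_left integrable_mult_right integrable_abs\<close>)
  have kmeas: "case_prod k \<in> borel_measurable (lborel \<Otimes>\<^sub>M lborel)"
    unfolding k_def by (simp add: indicator_def atMost_iff) measurable
  have k: "integrable (lborel \<Otimes>\<^sub>M lborel) (case_prod k)"
    by (rule Bochner_Integration.integrable_bound[OF hh kmeas])
       (auto simp: k_def indicator_def)
  have inner: "(LINT r|lborel. k s r) = G s * h s" for s
  proof (cases "s \<le> t")
    case True
    have "(LINT r|lborel. k s r) = (LINT r|lborel. h s * (indicat_real {..s} r * h r))"
      unfolding k_def by (simp add: mult_ac)
    then show ?thesis using GG[OF True] by simp
  qed (simp add: h_def k_def)
  have int: "integrable lborel (\<lambda>s. G s * h s)"
    using lborel_pair.integrable_fst[OF k] by (simp add: inner)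
  moreover have Gh: "indicat_real {0..t} s *\<^sub>R (G s * g s) = G s * h s" for s
    by (simp add: h_def)
  ultimately show "set_integrable lborel {0..t} (\<lambda>s. G s * g s)"
    unfolding set_integrable_def Gh by simp
  \<comment> \<open>Integrating over \<open>s\<close> first leaves the mass of \<open>h\<close> to
    the right of \<open>r\<close>, the total minus \<open>G r\<close>; the diagonal point
    \<open>s = r\<close> is a null set. Equating both orders gives the square of the total as twice
    the integral.\<close>
  have swapped: "(LINT s|lborel. k s r) = h r * (LINT s|lborel. h s) - G r * h r" for r
  proof (cases "r \<le> t")
    case True
    have "(LINT s|lborel. k s r) = (LINT s|lborel. h r * (h s - indicat_real {..r} s * h s))"
    proof (intro integral_cong_AE)
      show "AE s in lborel. k s r = h r * (h s - indicat_real {..r} s * h s)"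
        using AE_lborel_singleton[of r] by eventually_elim (auto simp: k_def indicator_def mult_ac)
      show "(\<lambda>s. k s r) \<in> borel_measurable lborel"
        unfolding k_def by (simp add: indicator_def)
    qed measurable
    also have "\<dots> = h r * (LINT s|lborel. h s - indicat_real {..r} s * h s)" by simp
    also have "(LINT s|lborel. h s - indicat_real {..r} s * h s) = (LINT s|lborel. h s) - G r"
      unfolding GG[OF True]
      by (intro Bochner_Integration.integral_diff h integrable_mult_indicator[of _ lborel h, simplified]) auto
    finally show ?thesis by (simp add: algebra_simps)
  qed (simp add: h_def k_def)
  have "(LINT s|lborel. G s * h s) = (LINT r|lborel. h r * (LINT s|lborel. h s) - G r * h r)"
    using lborel_pair.Fubini_integral[OF k] by (simp add: inner swapped)
  also have "\<dots> = (LINT s|lborel. h s)\<^sup>2 - (LINT s|lborel. G s * h s)"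
    using h int by (simp add: power2_eq_square)
  also have "(LINT s|lborel. h s) = G t"
    unfolding G_def set_lebesgue_integral_def h_def by simp
  finally show "(G t)\<^sup>2 = 2 * (LINT s:{0..t}|lborel. G s * g s)"
    unfolding set_lebesgue_integral_def Gh by simp
qed

section \<open>Pathwise stability of the Dyson system\<close>

lemma set_integrable_sum:
  fixes f :: "'i \<Rightarrow> 'b \<Rightarrow> real"
  assumes "\<And>i. i \<in> I \<Longrightarrow> set_integrable M A (f i)"
  shows "set_integrable M A (\<lambda>x. \<Sum>i\<in>I. f i x)"
  using assms unfolding set_integrable_def by (simp add: sum_distrib_left)

lemma set_integral_sum:
  fixes f :: "'i \<Rightarrow> 'b \<Rightarrow> real"
  assumes "\<And>i. i \<in> I \<Longrightarrow> set_integrable M A (f i)"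
  shows "(LINT x:A|M. \<Sum>i\<in>I. f i x) = (\<Sum>i\<in>I. LINT x:A|M. f i x)"
  using assms unfolding set_integrable_def set_lebesgue_integral_def by (simp add: sum_distrib_left)

text \<open>Energy estimate for \<open>V = x - w - y\<close>. Everything is deterministic and
  phrased through integral equations, since \<open>x\<close> and \<open>y\<close> need not be
  differentiable at collisions. Order is required only at almost every time, which admits the common
  starting point.\<close>

lemma dyson_path_stability:
  fixes x y w :: "nat \<Rightarrow> real \<Rightarrow> real"
  assumes t: "0 \<le> t"
    and x_int: "\<And>i. i \<in> {1..N} \<Longrightarrow> set_integrable lborel {0..t} (\<lambda>s. dyson_drift N (\<lambda>k. x k s) i)"
    and y_int: "\<And>i. i \<in> {1..N} \<Longrightarrow> set_integrable lborel {0..t} (\<lambda>s. dyson_drift N (\<lambda>k. y k s) i)"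
    and x_eq: "\<And>i s. i \<in> {1..N} \<Longrightarrow> s \<in> {0..t} \<Longrightarrow>
          x i s = w i s + (LINT r:{0..s}|lborel. dyson_drift N (\<lambda>k. x k r) i)"
    and y_eq: "\<And>i s. i \<in> {1..N} \<Longrightarrow> s \<in> {0..t} \<Longrightarrow>
          y i s = (LINT r:{0..s}|lborel. dyson_drift N (\<lambda>k. y k r) i)"
    and w: "\<And>i s. i \<in> {1..N} \<Longrightarrow> s \<in> {0..t} \<Longrightarrow> \<bar>w i s\<bar> \<le> \<delta>"
    and x_mono: "AE s in lborel. s \<in> {0..t} \<longrightarrow> strict_mono_on {1..N} (\<lambda>i. x i s)"
    and y_mono: "AE s in lborel. s \<in> {0..t} \<longrightarrow> strict_mono_on {1..N} (\<lambda>i. y i s)"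
    and \<delta>: "0 \<le> \<delta>"
  shows "(\<Sum>i=1..N. (x i t - w i t - y i t)\<^sup>2) \<le> 16 * real N ^ 3 * \<delta>\<^sup>2 + 16 * real N * \<delta> * (\<Sum>i=1..N. \<bar>y i t\<bar>)"
proof -
  define dx where "dx = (\<lambda>i s. dyson_drift N (\<lambda>k. x k s) i)"
  define dy where "dy = (\<lambda>i s. dyson_drift N (\<lambda>k. y k s) i)"
  define V where "V = (\<lambda>i s. LINT r:{0..s}|lborel. dx i r - dy i r)"
  have int: "set_integrable lborel {0..s} (dx i)" "set_integrable lborel {0..s} (dy i)"
    if "i \<in> {1..N}" "s \<in> {0..t}" for i s
    using that x_int y_int unfolding dx_def dy_def
    by (auto intro: set_integrable_subset[of _ "{0..t}"])
  have V: "V i s = x i s - w i s - y i s" if "i \<in> {1..N}" "s \<in> {0..t}" for i s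
    using int[OF that] x_eq[OF that] y_eq[OF that] unfolding V_def
    by (simp add: dx_def dy_def set_integral_diff)
  have int_g: "set_integrable lborel {0..t} (\<lambda>s. dx i s - dy i s)" if "i \<in> {1..N}" for i
    using int[OF that] t by simp
  have intV: "set_integrable lborel {0..t} (\<lambda>s. V i s * (dx i s - dy i s))"
    and sqV: "(V i t)\<^sup>2 = 2 * (LINT s:{0..t}|lborel. V i s * (dx i s - dy i s))" if "i \<in> {1..N}" for i
    using set_lborel_integral_square[OF int_g[OF that]] unfolding V_def by auto
  \<comment> \<open>The bound \<open>\<delta>\<close> on the noise times the linear functional
    dominating the absolute drifts of both systems. Its integral telescopes to \<open>x - w\<close>
    and \<open>y\<close> at time \<open>t\<close>.\<close>
  define L where "L = (\<lambda>s. \<Sum>i=1..N. 2 * \<delta> * i * (dx i s + dy i s))"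
  have pointwise: "AE s\<in>{0..t} in lborel. (\<Sum>i=1..N. V i s * (dx i s - dy i s)) \<le> L s"
    using x_mono y_mono
  proof eventually_elim
    case (elim s)
    show ?case
    proof
      assume s: "s \<in> {0..t}"
      have mx: "strict_mono_on {1..N} (\<lambda>i. x i s)" and my: "strict_mono_on {1..N} (\<lambda>i. y i s)"
        using elim s by auto
      have "(\<Sum>i=1..N. V i s * (dx i s - dy i s))
          = (\<Sum>i=1..N. (x i s - y i s) * (dx i s - dy i s)) + (\<Sum>i=1..N. - w i s * (dx i s - dy i s))"
        using s by (simp add: V sum.distrib[symmetric] algebra_simps)
      also have "\<dots> \<le> (\<Sum>i=1..N. - w i s * (dx i s - dy i s))"
        using dyson_drift_monotone[OF mx my] by (simp add: dx_def dy_def)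
      also have "\<dots> \<le> (\<Sum>i=1..N. \<delta> * (\<bar>dx i s\<bar> + \<bar>dy i s\<bar>))"
      proof (rule sum_mono)
        fix i assume i: "i \<in> {1..N}"
        have "- w i s * (dx i s - dy i s) \<le> \<bar>w i s\<bar> * \<bar>dx i s - dy i s\<bar>"
          by (metis abs_ge_self abs_minus_cancel abs_mult)
        also have "\<dots> \<le> \<delta> * (\<bar>dx i s\<bar> + \<bar>dy i s\<bar>)"
          using w[OF i s] by (intro mult_mono) auto
        finally show "- w i s * (dx i s - dy i s) \<le> \<delta> * (\<bar>dx i s\<bar> + \<bar>dy i s\<bar>)" .
      qed
      also have "\<dots> = \<delta> * ((\<Sum>i=1..N. \<bar>dx i s\<bar>) + (\<Sum>i=1..N. \<bar>dy i s\<bar>))"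
        by (simp add: sum_distrib_left sum.distrib distrib_left)
      also have "\<dots> \<le> \<delta> * (2 * (\<Sum>i=1..N. i * dx i s) + 2 * (\<Sum>i=1..N. i * dy i s))"
        using sum_abs_dyson_drift_le[OF mx] sum_abs_dyson_drift_le[OF my]
        by (intro mult_left_mono add_mono \<delta>) (auto simp: dx_def dy_def)
      also have "\<dots> = L s"
        by (simp add: L_def sum_distrib_left sum.distrib algebra_simps)
      finally show "(\<Sum>i=1..N. V i s * (dx i s - dy i s)) \<le> L s" .
    qed
  qed
  have int_L: "set_integrable lborel {0..t} (\<lambda>s. 2 * \<delta> * i * (dx i s + dy i s))" if "i \<in> {1..N}" for i
    using int[OF that] t by simp
  have "(\<Sum>i=1..N. (V i t)\<^sup>2) = 2 * (LINT s:{0..t}|lborel. \<Sum>i=1..N. V i s * (dx i s - dy i s))"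
    by (subst set_integral_sum) (auto simp: sqV sum_distrib_left intro!: intV)
  also have "\<dots> \<le> 2 * (LINT s:{0..t}|lborel. L s)"
    using intV int_L pointwise unfolding L_def
    by (intro mult_left_mono set_integral_mono_AE set_integrable_sum) auto
  also have "(LINT s:{0..t}|lborel. L s) = (\<Sum>i=1..N. 2 * \<delta> * i * (x i t - w i t + y i t))"
    unfolding L_def using int_L int t x_eq y_eq
    by (subst set_integral_sum) (auto simp: dx_def dy_def intro!: sum.cong)
  \<comment> \<open>With \<open>x - w = V + y\<close> each term equals
    \<open>4 * \<delta> * i * (V + 2 * y)\<close>. Young's inequality
    \<open>4 * \<delta> * N * |V| \<le> V^2 / 2 + 8 * N^2 * \<delta>^2\<close> leaves half of
    \<open>|V|^2\<close> to be absorbed on the left; doubling then produces the constants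
    16.\<close>
  also have "2 * \<dots> \<le> (\<Sum>i=1..N. ((V i t)\<^sup>2 / 2 + 8 * real N ^ 2 * \<delta>\<^sup>2) + 8 * real N * \<delta> * \<bar>y i t\<bar>)"
    unfolding sum_distrib_left
  proof (rule sum_mono)
    fix i assume i: "i \<in> {1..N}"
    have "2 * (2 * \<delta> * i * (x i t - w i t + y i t)) = 4 * \<delta> * i * (V i t + 2 * y i t)"
      using V[OF i] t by simp
    also have "\<dots> \<le> 4 * \<delta> * N * (\<bar>V i t\<bar> + 2 * \<bar>y i t\<bar>)"
      using i \<delta> by (intro order.trans[OF mult_left_mono mult_right_mono]) (auto intro!: mult_left_mono)
    also have "4 * \<delta> * N * \<bar>V i t\<bar> \<le> (V i t)\<^sup>2 / 2 + 8 * real N ^ 2 * \<delta>\<^sup>2"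
      using zero_le_power2[of "\<bar>V i t\<bar> - 4 * \<delta> * N"]
      by (simp add: power2_diff power_mult_distrib algebra_simps)
    ultimately show "2 * (2 * \<delta> * i * (x i t - w i t + y i t))
        \<le> ((V i t)\<^sup>2 / 2 + 8 * real N ^ 2 * \<delta>\<^sup>2) + 8 * real N * \<delta> * \<bar>y i t\<bar>"
      by (simp add: algebra_simps)
  qed
  also have "\<dots> = (\<Sum>i=1..N. (V i t)\<^sup>2) / 2 + 8 * real N ^ 3 * \<delta>\<^sup>2 + 8 * real N * \<delta> * (\<Sum>i=1..N. \<bar>y i t\<bar>)"
    by (simp add: sum.distrib sum_divide_distrib sum_distrib_left power3_eq_cube power2_eq_square)
  finally have "(\<Sum>i=1..N. (V i t)\<^sup>2) \<le> 16 * real N ^ 3 * \<delta>\<^sup>2 + 16 * real N * \<delta> * (\<Sum>i=1..N. \<bar>y i t\<bar>)"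
    by simp
  then show ?thesis
    using V t by simp
qed

section \<open>Zeros of the Hermite polynomials\<close>

text \<open>The Appell property. Differentiating the recurrence and inserting the two previous cases
  reproduces the recurrence one index lower.\<close>

lemma pderiv_hermite_Suc: "pderiv (hermite (Suc n)) = of_nat (Suc n) * hermite n"
proof (induction n rule: hermite.induct)
  case (3 n)
  have "pderiv (hermite (Suc (Suc (Suc n))))
      = hermite (Suc (Suc n)) + [:0, 1:] * pderiv (hermite (Suc (Suc n)))
        - of_nat (Suc (Suc n)) * pderiv (hermite (Suc n))"
    unfolding hermite.simps(3)[of "Suc n"]
    by (simp add: pderiv_diff pderiv_mult pderiv_pCons del: hermite.simps(3) of_nat_Suc)
  also have "\<dots> = hermite (Suc (Suc n)) + of_nat (Suc (Suc n)) * hermite (Suc (Suc n))"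
  proof -
    have "of_nat (Suc (Suc n)) * hermite (Suc (Suc n))
        = [:0, 1:] * (of_nat (Suc (Suc n)) * hermite (Suc n))
          - of_nat (Suc (Suc n)) * (of_nat (Suc n) * hermite n)"
      unfolding hermite.simps(3)[of n] by (simp only: right_diff_distrib mult_ac)
    then show ?thesis unfolding 3 by (simp only: add_diff_eq)
  qed
  also have "\<dots> = of_nat (Suc (Suc (Suc n))) * hermite (Suc (Suc n))"
    unfolding of_nat_Suc[of "Suc (Suc n)"] by (simp only: distrib_right mult_1)
  finally show ?case .
qed (auto simp: pderiv_pCons pderiv_diff pderiv_mult numeral_2_eq_2 one_pCons of_nat_poly)

lemma hermite_ode:
  "pderiv (pderiv (hermite n)) = [:0, 1:] * pderiv (hermite n) - of_nat n * hermite n"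
proof (cases n rule: hermite.cases)
  case (3 m)
  have "pderiv (pderiv (hermite n)) = of_nat n * (of_nat (Suc m) * hermite m)"
    unfolding 3 pderiv_hermite_Suc by (simp add: pderiv_mult pderiv_hermite_Suc del: hermite.simps of_nat_Suc)
  then show ?thesis
    unfolding 3 pderiv_hermite_Suc by (simp only: hermite.simps(3) algebra_simps)
qed (auto simp: pderiv_pCons one_pCons)

lemma degree_hermite_le: "degree (hermite n) \<le> n"
  and coeff_hermite_self: "coeff (hermite n) n = 1"
proof (induction n rule: hermite.induct)
  case (3 n)
  { case 1 show ?case using 3 by (auto intro!: degree_diff_le simp: degree_pCons_le of_nat_poly intro: order.trans[OF degree_pCons_le]) }
  { case 2 have "coeff (hermite n) (Suc (Suc n)) = 0" using 3(3) by (intro coeff_eq_0) auto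
    then show ?case using 3 by (simp add: of_nat_poly) }
qed auto

text \<open>Both sides are monic of degree \<open>N\<close>, so their difference has degree below
  \<open>N\<close> or is 0; but it vanishes at the \<open>N\<close> distinct points
  \<open>z i\<close>.\<close>

lemma hermite_eq_prod:
  assumes z: "inj_on z {1..N}" "z ` {1..N} = {x. poly (hermite N) x = 0}"
  shows "hermite N = (\<Prod>i=1..N. [:- z i, 1:])"
proof (cases "N = 0")
  case False
  let ?p = "\<Prod>i=1..N. [:- z i, 1:]"
  let ?d = "hermite N - ?p"
  have deg: "degree ?p = N"
    by (subst degree_prod_sum_eq) auto
  have "coeff ?p N = 1"
    using lead_coeff_prod[of "\<lambda>i. [:- z i, 1:]" "{1..N}"] unfolding deg by simp
  then have "coeff ?d N = 0"
    by (simp add: coeff_hermite_self)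
  moreover have "degree ?d \<le> N"
    using deg degree_hermite_le[of N] by (intro degree_diff_le) auto
  ultimately have "?d = 0 \<or> degree ?d < N"
    by (rule eq_zero_or_degree_less[rotated])
  moreover have "N \<le> degree ?d" if "?d \<noteq> 0"
  proof -
    have "z ` {1..N} \<subseteq> {x. poly ?d x = 0}"
    proof safe
      fix i assume i: "i \<in> {1..N}"
      then have "poly (hermite N) (z i) = 0" using z(2) by blast
      moreover have "poly ?p (z i) = 0" using i by (auto simp: poly_prod)
      ultimately show "poly ?d (z i) = 0" by simp
    qed
    then have "card (z ` {1..N}) \<le> card {x. poly ?d x = 0}"
      using that by (intro card_mono poly_roots_finite)
    also have "\<dots> \<le> degree ?d"
      using that by (rule card_poly_roots_bound)
    finally show ?thesis
      using card_image[OF z(1)] by simp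
  qed
  ultimately show ?thesis by fastforce
qed simp

text \<open>Stieltjes' relation: dividing the Hermite equation by \<open>H'\<close> at a zero.\<close>

lemma dyson_drift_hermite_zeros:
  assumes inj: "inj_on z {1..N}" and z: "z ` {1..N} = {x. poly (hermite N) x = 0}" and i: "i \<in> {1..N}"
  shows "dyson_drift N z i = z i / 2"
proof -
  let ?I = "{1..N} - {i}"
  \<comment> \<open>As \<open>hermite N = (X - z i) * q\<close>, at \<open>z i\<close> the first
    derivative is \<open>q\<close> and the second is \<open>2 * q'\<close>. The logarithmic
    derivative \<open>q' / q\<close> there is exactly the drift.\<close>
  define q where "q = (\<Prod>j\<in>?I. [:- z j, 1:])"
  have H: "hermite N = [:- z i, 1:] * q"
    unfolding hermite_eq_prod[OF inj z] q_def using i by (subst prod.remove[of _ i]) auto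
  have neq: "z i \<noteq> z j" if "j \<in> ?I" for j
    using inj i that by (auto dest: inj_onD)
  have q0: "poly q (z i) \<noteq> 0"
    unfolding q_def poly_prod using neq by (subst prod_zero_iff) force+
  have "poly (pderiv q) (z i) = (\<Sum>j\<in>?I. \<Prod>k\<in>?I - {j}. z i - z k)"
    unfolding q_def pderiv_prod by (simp add: poly_sum poly_prod pderiv_pCons del: atLeastAtMost_iff)
  also have "\<dots> = (\<Sum>j\<in>?I. poly q (z i) * (1 / (z i - z j)))"
  proof (rule sum.cong)
    fix j assume j: "j \<in> ?I"
    then have "z i - z j \<noteq> 0" using neq by simp
    then show "(\<Prod>k\<in>?I - {j}. z i - z k) = poly q (z i) * (1 / (z i - z j))"
      unfolding q_def poly_prod using j prod.remove[of ?I j "\<lambda>k. z i - z k"] by simp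
  qed simp
  also have "\<dots> = poly q (z i) * dyson_drift N z i"
    by (simp add: dyson_drift_def sum_distrib_left)
  finally have q': "poly (pderiv q) (z i) = poly q (z i) * dyson_drift N z i" .
  have "pderiv (hermite N) = q + [:- z i, 1:] * pderiv q"
    unfolding H pderiv_mult by (simp add: pderiv_pCons)
  then have H': "poly (pderiv (hermite N)) (z i) = poly q (z i)"
    and "pderiv (pderiv (hermite N)) = 2 * pderiv q + [:- z i, 1:] * pderiv (pderiv q)"
    by (auto simp: pderiv_add pderiv_diff pderiv_smult pderiv_mult pderiv_pCons)
  then have "poly (pderiv (pderiv (hermite N))) (z i) = 2 * poly (pderiv q) (z i)"
    by simp
  moreover have "poly (hermite N) (z i) = 0" using z i by blast
  then have "poly (pderiv (pderiv (hermite N))) (z i) = z i * poly (pderiv (hermite N)) (z i)"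
    unfolding hermite_ode by simp
  ultimately show ?thesis
    using q0 by (simp add: q' H')
qed

section \<open>The noiseless solution\<close>

text \<open>Homogeneity of degree -1. It includes \<open>c = 0\<close>, where both sides are 0 by
  the convention for division, so time 0 needs no separate treatment.\<close>

lemma dyson_drift_scale: "dyson_drift N (\<lambda>k. c * x k) i = dyson_drift N x i / c"
  by (simp add: dyson_drift_def right_diff_distrib[symmetric] sum_divide_distrib mult.commute)

text \<open>The integrand is unbounded at 0, so the fundamental theorem is used with the derivative
  known only in the open interval; nonnegativity then upgrades the gauge integral to a Lebesgue
  integral.\<close>

lemma set_integrable_inverse_sqrt:
  assumes "0 \<le> t"
  shows "set_integrable lborel {0..t} (\<lambda>s. 1 / (2 * sqrt s))"
    and "(LINT s:{0..t}|lborel. 1 / (2 * sqrt s)) = sqrt t"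
proof -
  have hi: "((\<lambda>s. 1 / (2 * sqrt s)) has_integral sqrt t - sqrt 0) {0..t}"
    using assms by (intro fundamental_theorem_of_calculus_interior)
      (auto intro!: continuous_intros derivative_eq_intros simp: has_real_derivative_iff_has_vector_derivative[symmetric] field_simps)
  then have "(\<lambda>s. 1 / (2 * sqrt s)) absolutely_integrable_on {0..t}"
    by (intro nonnegative_absolutely_integrable_1) auto
  then show int: "set_integrable lborel {0..t} (\<lambda>s. 1 / (2 * sqrt s))"
    unfolding set_integrable_def by (subst (asm) integrable_completion) auto
  show "(LINT s:{0..t}|lborel. 1 / (2 * sqrt s)) = sqrt t"
    using set_borel_integral_eq_integral(2)[OF int] hi by (simp add: integral_unique)
qed

lemma hermite_flow:
  assumes inj: "inj_on z {1..N}" and z: "z ` {1..N} = {x. poly (hermite N) x = 0}"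
    and i: "i \<in> {1..N}" and "0 \<le> t"
  shows "set_integrable lborel {0..t} (\<lambda>s. dyson_drift N (\<lambda>k. sqrt s * z k) i)"
    and "(LINT s:{0..t}|lborel. dyson_drift N (\<lambda>k. sqrt s * z k) i) = sqrt t * z i"
proof -
  have eq: "dyson_drift N (\<lambda>k. sqrt s * z k) i = z i * (1 / (2 * sqrt s))" for s
    by (simp add: dyson_drift_scale dyson_drift_hermite_zeros[OF inj z i])
  show "set_integrable lborel {0..t} (\<lambda>s. dyson_drift N (\<lambda>k. sqrt s * z k) i)"
    unfolding eq by (intro set_integrable_mult_right set_integrable_inverse_sqrt assms)
  show "(LINT s:{0..t}|lborel. dyson_drift N (\<lambda>k. sqrt s * z k) i) = sqrt t * z i"
    unfolding eq set_integral_mult_right set_integrable_inverse_sqrt[OF \<open>0 \<le> t\<close>] by simp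
qed

section \<open>Convergence of the particle system\<close>

lemma tendsto_fun_iff:
  fixes f :: "'c \<Rightarrow> 'a \<Rightarrow> 'b::topological_space"
  shows "(f \<longlongrightarrow> l) F \<longleftrightarrow> (\<forall>i. ((\<lambda>x. f x i) \<longlongrightarrow> l i) F)"
  using limitin_componentwise[of "\<lambda>_. euclidean :: 'b topology" UNIV f l F]
  by (simp add: euclidean_product_topology)

text \<open>Configurations are functions on \<open>nat\<close> with the product topology; the coordinates outside
  \<open>{1..N}\<close> are irrelevant, and nothing is assumed about them.\<close>

definition restrict0 :: "nat \<Rightarrow> (nat \<Rightarrow> real) \<Rightarrow> nat \<Rightarrow> real" where
  "restrict0 N x = (\<lambda>i. if i \<in> {1..N} then x i else 0)"

lemma continuous_on_restrict0:
  assumes "\<And>i. i \<in> {1..N} \<Longrightarrow> continuous_on S (\<lambda>s. x s i)"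
  shows "continuous_on S (\<lambda>s. restrict0 N (x s))"
proof (rule continuous_on_coordinatewise_then_product)
  show "continuous_on S (\<lambda>s. restrict0 N (x s) i)" for i
    using assms unfolding restrict0_def by (cases "i \<in> {1..N}") auto
qed

text \<open>By contradiction: violating times have a convergent subsequence, the configurations
  follow \<open>y\<close> and so converge coordinatewise, and continuity of \<open>G\<close> at the
  limit contradicts \<open>zero\<close>. Setting the outer coordinates to 0 makes them converge as
  well.\<close>

lemma uniform_smallness_near_path:
  fixes G :: "real \<Rightarrow> (nat \<Rightarrow> real) \<Rightarrow> real" and y :: "nat \<Rightarrow> real \<Rightarrow> real"
  assumes G: "continuous_on ({0..T} \<times> UNIV) (\<lambda>(t, x). G t x)"
    and y: "\<And>i. i \<in> {1..N} \<Longrightarrow> continuous_on {0..T} (y i)"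
    and zero: "\<And>t. t \<in> {0..T} \<Longrightarrow> G t (restrict0 N (\<lambda>i. y i t)) = 0"
    and "0 < \<epsilon>"
  shows "\<exists>\<eta>>0. \<forall>t\<in>{0..T}. \<forall>x. (\<forall>i\<in>{1..N}. \<bar>x i - y i t\<bar> < \<eta>) \<longrightarrow> G t (restrict0 N x) < \<epsilon>"
proof (rule ccontr)
  assume contr: "\<not> ?thesis"
  have "\<exists>t x. t \<in> {0..T} \<and> (\<forall>i\<in>{1..N}. \<bar>x i - y i t\<bar> < 1 / real (Suc n)) \<and> \<epsilon> \<le> G t (restrict0 N x)" for n
  proof -
    have "0 < 1 / real (Suc n)" by simp
    then show ?thesis using contr by (meson not_less)
  qed
  then obtain \<tau> x where \<tau>: "\<And>n. \<tau> n \<in> {0..T}"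
    and x: "\<And>n i. i \<in> {1..N} \<Longrightarrow> \<bar>x n i - y i (\<tau> n)\<bar> < 1 / real (Suc n)"
    and ge: "\<And>n. \<epsilon> \<le> G (\<tau> n) (restrict0 N (x n))"
    by metis
  obtain t r where t: "t \<in> {0..T}" and r: "strict_mono r" and lim: "(\<tau> \<circ> r) \<longlonglongrightarrow> t"
    using compact_Icc[of 0 T] \<tau> unfolding compact_def by metis
  have "(\<lambda>n. restrict0 N (x (r n)) i) \<longlonglongrightarrow> restrict0 N (\<lambda>i. y i t) i" for i
  proof (cases "i \<in> {1..N}")
    case True
    have "(\<lambda>n. y i (\<tau> (r n))) \<longlonglongrightarrow> y i t"
      using continuous_on_tendsto_compose[OF y[OF True] lim t] \<tau> by simp
    moreover have "(\<lambda>n. x (r n) i - y i (\<tau> (r n))) \<longlonglongrightarrow> 0"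
    proof (rule Lim_null_comparison)
      show "\<forall>\<^sub>F n in sequentially. norm (x (r n) i - y i (\<tau> (r n))) \<le> 1 / real (Suc (r n))"
        using x[OF True] by (auto intro!: always_eventually less_imp_le)
      show "(\<lambda>n. 1 / real (Suc (r n))) \<longlonglongrightarrow> 0"
        using LIMSEQ_subseq_LIMSEQ[OF lim_1_over_n[THEN LIMSEQ_Suc] r] by (simp add: o_def)
    qed
    ultimately have "(\<lambda>n. (x (r n) i - y i (\<tau> (r n))) + y i (\<tau> (r n))) \<longlonglongrightarrow> 0 + y i t"
      by (intro tendsto_add)
    then show ?thesis using True by (simp add: restrict0_def)
  next
    case False
    then have "restrict0 N f i = 0" for f by (auto simp: restrict0_def)
    then show ?thesis by simp
  qed
  then have "(\<lambda>n. restrict0 N (x (r n))) \<longlonglongrightarrow> restrict0 N (\<lambda>i. y i t)"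
    by (simp add: tendsto_fun_iff)
  then have "(\<lambda>n. (\<tau> (r n), restrict0 N (x (r n)))) \<longlonglongrightarrow> (t, restrict0 N (\<lambda>i. y i t))"
    using lim by (intro tendsto_Pair) (auto simp: o_def)
  from continuous_on_tendsto_compose[OF G this]
  have "(\<lambda>n. G (\<tau> (r n)) (restrict0 N (x (r n)))) \<longlonglongrightarrow> 0"
    using t \<tau> zero by simp
  then have "\<epsilon> \<le> 0"
    using ge by (intro LIMSEQ_le_const) auto
  then show False using \<open>0 < \<epsilon>\<close> by simp
qed

text \<open>\<open>\<delta>\<close> is chosen before \<open>x\<close> and \<open>w\<close>. Hence
  one \<open>\<delta>\<close> serves all sample paths and all \<open>\<beta>\<close>, which enters
  only through the size of \<open>w\<close>.\<close>

lemma dyson_path_near_hermite_flow: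
  fixes z :: "nat \<Rightarrow> real"
  assumes mono: "strict_mono_on {1..N} z" and z: "z ` {1..N} = {x. poly (hermite N) x = 0}" and "0 < \<eta>"
  shows "\<exists>\<delta>>0. \<forall>x w.
      (\<forall>i\<in>{1..N}. set_integrable lborel {0..T} (\<lambda>s. dyson_drift N (\<lambda>k. x k s) i)) \<longrightarrow>
      (\<forall>i\<in>{1..N}. \<forall>s\<in>{0..T}. x i s = w i s + (LINT r:{0..s}|lborel. dyson_drift N (\<lambda>k. x k r) i)) \<longrightarrow>
      (AE s in lborel. 0 \<le> s \<longrightarrow> strict_mono_on {1..N} (\<lambda>i. x i s)) \<longrightarrow>
      (\<forall>i\<in>{1..N}. \<forall>s\<in>{0..T}. \<bar>w i s\<bar> \<le> \<delta>) \<longrightarrow>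
      (\<forall>t\<in>{0..T}. \<forall>i\<in>{1..N}. \<bar>x i t - sqrt t * z i\<bar> < \<eta>)"
proof -
  define K where "K = (\<Sum>i=1..N. sqrt \<bar>T\<bar> * \<bar>z i\<bar>)"
  \<comment> \<open>The total error: \<open>\<delta>\<close> for the noise itself and the root of
    the stability bound for \<open>V\<close>. It tends to 0 with \<open>\<delta>\<close>.\<close>
  define h where "h = (\<lambda>\<delta>. \<delta> + sqrt (16 * real N ^ 3 * \<delta>\<^sup>2 + 16 * real N * \<delta> * K))"
  have "(h \<longlongrightarrow> h 0) (at_right 0)"
    unfolding h_def by (auto intro!: tendsto_eq_intros)
  then have "\<forall>\<^sub>F \<delta> in at_right 0. h \<delta> < \<eta>"
    using \<open>0 < \<eta>\<close> by (intro order_tendstoD(2)) (auto simp: h_def)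
  then have "\<forall>\<^sub>F \<delta> in at_right 0. h \<delta> < \<eta> \<and> 0 < \<delta>"
    using eventually_at_right_less[of 0] by (rule eventually_conj)
  then obtain \<delta> where \<delta>: "h \<delta> < \<eta>" "0 < \<delta>"
    using eventually_happens'[OF trivial_limit_at_right_real] by blast
  show ?thesis
  proof (intro exI[of _ \<delta>] conjI allI impI ballI)
    fix x w t i
    assume x_int: "\<forall>i\<in>{1..N}. set_integrable lborel {0..T} (\<lambda>s. dyson_drift N (\<lambda>k. x k s) i)"
      and x_eq: "\<forall>i\<in>{1..N}. \<forall>s\<in>{0..T}. x i s = w i s + (LINT r:{0..s}|lborel. dyson_drift N (\<lambda>k. x k r) i)"
      and x_mono: "AE s in lborel. 0 \<le> s \<longrightarrow> strict_mono_on {1..N} (\<lambda>i. x i s)"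
      and w: "\<forall>i\<in>{1..N}. \<forall>s\<in>{0..T}. \<bar>w i s\<bar> \<le> \<delta>"
      and t: "t \<in> {0..T}" and i: "i \<in> {1..N}"
    let ?y = "\<lambda>i t. sqrt t * z i"
    have inj: "inj_on z {1..N}" using mono by (rule strict_mono_on_imp_inj_on)
    have "(\<Sum>i=1..N. (x i t - w i t - ?y i t)\<^sup>2)
        \<le> 16 * real N ^ 3 * \<delta>\<^sup>2 + 16 * real N * \<delta> * (\<Sum>i=1..N. \<bar>?y i t\<bar>)"
    proof (rule dyson_path_stability[where x = x and w = w and y = ?y])
      show "set_integrable lborel {0..t} (\<lambda>s. dyson_drift N (\<lambda>k. x k s) i)" if "i \<in> {1..N}" for i
        by (rule set_integrable_subset[OF bspec[OF x_int that]]) (use t in auto)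
      show "set_integrable lborel {0..t} (\<lambda>s. dyson_drift N (\<lambda>k. ?y k s) i)" if "i \<in> {1..N}" for i
        using hermite_flow(1)[OF inj z that] t by simp
      show "?y i s = (LINT r:{0..s}|lborel. dyson_drift N (\<lambda>k. ?y k r) i)"
        if "i \<in> {1..N}" "s \<in> {0..t}" for i s
        using hermite_flow(2)[OF inj z that(1)] that(2) by simp
      show "AE s in lborel. s \<in> {0..t} \<longrightarrow> strict_mono_on {1..N} (\<lambda>i. x i s)"
        using x_mono by eventually_elim auto
      \<comment> \<open>At \<open>s = 0\<close> the limiting particles all sit at 0; this single
        time is discarded.\<close>
      show "AE s in lborel. s \<in> {0..t} \<longrightarrow> strict_mono_on {1..N} (\<lambda>i. ?y i s)"
        using AE_lborel_singleton[of 0]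
      proof eventually_elim
        case (elim s)
        then show ?case
          using strict_mono_onD[OF mono] by (auto intro!: strict_mono_onI)
      qed
    qed (use x_eq w t \<delta> in auto)
    also have "(\<Sum>i=1..N. \<bar>?y i t\<bar>) \<le> K"
      unfolding K_def using t by (intro sum_mono) (auto simp: abs_mult intro!: mult_right_mono)
    finally have "(\<Sum>i=1..N. (x i t - w i t - ?y i t)\<^sup>2) \<le> 16 * real N ^ 3 * \<delta>\<^sup>2 + 16 * real N * \<delta> * K"
      using \<delta> by (simp add: mult_left_mono)
    moreover have "(x i t - w i t - ?y i t)\<^sup>2 \<le> (\<Sum>i=1..N. (x i t - w i t - ?y i t)\<^sup>2)"
      using i by (intro member_le_sum) auto
    ultimately have "\<bar>x i t - w i t - ?y i t\<bar> \<le> h \<delta> - \<delta>"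
      unfolding h_def by (auto intro!: real_le_rsqrt)
    moreover have "\<bar>w i t\<bar> \<le> \<delta>" using w i t by blast
    ultimately show "\<bar>x i t - sqrt t * z i\<bar> < \<eta>"
      using \<delta> by linarith
  qed (use \<delta> in auto)
qed

section \<open>Measurability and almost sure path properties\<close>

lemma closure_Icc_Int_Rats:
  fixes T :: real
  assumes "0 < T"
  shows "closure ({0..T} \<inter> \<rat>) = {0..T}"
proof -
  have "closure ({0..T} \<inter> \<rat>) = closure {0..T}"
    using assms by (intro closure_convex_Int_superset) (auto simp: Rats_closure_real)
  then show ?thesis by simp
qed

text \<open>Replaces an uncountable supremum by a countable one, which is what makes the events in
  \<open>uniformly_vanishes_in_prob\<close> measurable.\<close>

lemma SUP_Icc_Int_Rats:
  fixes h :: "real \<Rightarrow> real"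
  assumes T: "0 < T" and h: "continuous_on {0..T} h"
  shows "(SUP t\<in>{0..T}. ereal (h t)) = (SUP t\<in>{0..T} \<inter> \<rat>. ereal (h t))" (is "_ = ?S")
proof (rule antisym)
  show "(SUP t\<in>{0..T}. ereal (h t)) \<le> ?S"
  proof (rule SUP_least)
    fix t assume t: "t \<in> {0..T}"
    show "ereal (h t) \<le> ?S"
    proof (cases ?S)
      case (real r)
      have "h d \<le> r" if "d \<in> {0..T} \<inter> \<rat>" for d
        using SUP_upper[of d "{0..T} \<inter> \<rat>" "\<lambda>t. ereal (h t)"] that real by simp
      then have "h t \<le> r"
        using continuous_le_on_closure[of "{0..T} \<inter> \<rat>" h t r] closure_Icc_Int_Rats[OF T] h t by auto
      then show ?thesis using real by simp
    next
      case MInf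
      have "0 \<in> {0..T} \<inter> \<rat>" using T by simp
      then have "ereal (h 0) \<le> ?S" by (rule SUP_upper)
      then show ?thesis using MInf by simp
    qed simp
  qed
qed (rule SUP_subset_mono; auto)

text \<open>The augmented filtration contains null sets of the completion, so measurability can be
  asserted only with respect to \<open>completion M\<close>, not \<open>M\<close>.\<close>

lemma measurable_brownian_filtration_completion:
  assumes X: "X \<in> borel_measurable (brownian_filtration M N b t)"
    and b: "\<And>i s. i \<in> {1..N} \<Longrightarrow> 0 \<le> s \<Longrightarrow> b i s \<in> borel_measurable M"
  shows "X \<in> borel_measurable (completion M)"
proof -
  let ?G = "{b i s -` A \<inter> space M | i s A. i \<in> {1..N} \<and> 0 \<le> s \<and> s \<le> t \<and> A \<in> sets borel}
        \<union> null_sets (completion M)"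
  have sub: "?G \<subseteq> sets (completion M)"
    using measurable_sets[OF b] by (blast intro: sets_completionI_sets null_setsD2)
  then have "?G \<subseteq> Pow (space M)"
    using sets.space_closed[of "completion M"] by auto
  then have space: "space (brownian_filtration M N b t) = space M"
    and sets: "sets (brownian_filtration M N b t) = sigma_sets (space M) ?G"
    unfolding brownian_filtration_def by (auto intro: space_measure_of sets_measure_of)
  have "sigma_sets (space M) ?G \<subseteq> sets (completion M)"
    using sets.sigma_sets_subset[OF sub] by simp
  then show ?thesis
    using X sets space unfolding measurable_def by auto
qed

text \<open>The events that some path exceeds \<open>n\<close> decrease to a null set, because a
  continuous path is bounded on a compact interval; continuity of the measure from above then yields
  \<open>n\<close>. Rational times keep the events measurable, and density extends the bound to all
  times.\<close>

lemma brownian_paths_bounded: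
  assumes "prob_space M" and b: "independent_brownian_motions M N b" and T: "0 < T" and "0 < \<epsilon>"
  shows "\<exists>A\<in>sets M. \<exists>n::nat. measure M A < \<epsilon> \<and>
      (AE \<omega> in M. \<omega> \<notin> A \<longrightarrow> (\<forall>i\<in>{1..N}. \<forall>t\<in>{0..T}. \<bar>b i t \<omega>\<bar> \<le> real n))"
proof -
  interpret prob_space M by fact
  define A where "A = (\<lambda>n. \<Union>i\<in>{1..N}. \<Union>t\<in>{0..T} \<inter> \<rat>. {\<omega> \<in> space M. real n < \<bar>b i t \<omega>\<bar>})"
  have meas: "b i t \<in> borel_measurable M" if "i \<in> {1..N}" "0 \<le> t" for i t
    using b that unfolding independent_brownian_motions_def std_brownian_motion_def by blast
  have A: "A n \<in> sets M" for n
    unfolding A_def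
  proof (intro sets.countable_UN'' sets.finite_UN)
    fix i t assume *: "i \<in> {1..N}" "t \<in> {0..T} \<inter> \<rat>"
    then have [measurable]: "b i t \<in> borel_measurable M" using meas by auto
    show "{\<omega> \<in> space M. real n < \<bar>b i t \<omega>\<bar>} \<in> sets M" by measurable
  qed (auto intro: countable_Int2 countable_rat)
  have cont: "AE \<omega> in M. \<forall>i\<in>{1..N}. continuous_on {0..T} (\<lambda>t. b i t \<omega>)"
  proof (rule AE_finite_allI)
    fix i assume i: "i \<in> {1..N}"
    have "AE \<omega> in M. continuous_on {0..} (\<lambda>t. b i t \<omega>)"
      using b i unfolding independent_brownian_motions_def std_brownian_motion_def by blast
    then show "AE \<omega> in M. continuous_on {0..T} (\<lambda>t. b i t \<omega>)"
      by eventually_elim (auto intro: continuous_on_subset)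
  qed simp
  have "AE \<omega> in M. \<omega> \<notin> (\<Inter>n. A n)"
    using cont
  proof eventually_elim
    case (elim \<omega>)
    have "\<exists>B. \<forall>t\<in>{0..T}. \<bar>b i t \<omega>\<bar> \<le> B" if "i \<in> {1..N}" for i
      using compact_imp_bounded[OF compact_continuous_image[OF bspec[OF elim that] compact_Icc]]
      unfolding bounded_iff by auto
    then obtain B where B: "\<And>i t. i \<in> {1..N} \<Longrightarrow> t \<in> {0..T} \<Longrightarrow> \<bar>b i t \<omega>\<bar> \<le> B i"
      by metis
    obtain n :: nat where n: "(\<Sum>i=1..N. \<bar>B i\<bar>) \<le> real n"
      using real_arch_simple by blast
    have "\<bar>b i t \<omega>\<bar> \<le> real n" if "i \<in> {1..N}" "t \<in> {0..T}" for i t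
    proof -
      have "\<bar>B i\<bar> \<le> (\<Sum>i=1..N. \<bar>B i\<bar>)" using that by (intro member_le_sum) auto
      then show ?thesis using B[OF that] n by linarith
    qed
    then have "\<omega> \<notin> A n" unfolding A_def by (auto simp: not_less)
    then show ?case by blast
  qed
  then have "measure M (\<Inter>n. A n) = 0"
    using A by (subst prob_eq_0) auto
  moreover have "(\<lambda>n. measure M (A n)) \<longlonglongrightarrow> measure M (\<Inter>n. A n)"
  proof (rule finite_Lim_measure_decseq)
    show "decseq A"
    proof (rule decseq_SucI)
      show "A (Suc n) \<subseteq> A n" for n
        unfolding A_def by (intro UN_mono) auto
    qed
  qed (use A in auto)
  ultimately have "\<forall>\<^sub>F n in sequentially. measure M (A n) < \<epsilon>"
    using \<open>0 < \<epsilon>\<close> by (intro order_tendstoD(2)) auto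
  then obtain n where n: "measure M (A n) < \<epsilon>"
    using eventually_happens'[OF sequentially_bot] by blast
  have "AE \<omega> in M. \<omega> \<notin> A n \<longrightarrow> (\<forall>i\<in>{1..N}. \<forall>t\<in>{0..T}. \<bar>b i t \<omega>\<bar> \<le> real n)"
    using cont AE_space
  proof eventually_elim
    case (elim \<omega>)
    show ?case
    proof (intro impI ballI)
      fix i t assume *: "\<omega> \<notin> A n" "i \<in> {1..N}" "t \<in> {0..T}"
      have "\<bar>b i d \<omega>\<bar> \<le> real n" if "d \<in> {0..T} \<inter> \<rat>" for d
        using *(1,2) elim(2) that unfolding A_def by (auto simp: not_less)
      moreover have "continuous_on {0..T} (\<lambda>t. \<bar>b i t \<omega>\<bar>)"
        using elim(1) *(2) by (auto intro!: continuous_intros)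
      ultimately show "\<bar>b i t \<omega>\<bar> \<le> real n"
        using continuous_le_on_closure[of "{0..T} \<inter> \<rat>" "\<lambda>t. \<bar>b i t \<omega>\<bar>" t "real n"]
          closure_Icc_Int_Rats[OF T] *(3) by simp
    qed
  qed
  then show ?thesis using A n by blast
qed

text \<open>Gathers the almost sure clauses into one event on which the deterministic estimates
  apply. Weak order at all times and distinctness at almost all times combine to strict order at
  almost all times.\<close>

lemma dyson_strong_solution_paths:
  assumes sol: "dyson_strong_solution M N b \<beta> X" and T: "0 \<le> T"
  shows "AE \<omega> in M.
      (\<forall>i\<in>{1..N}. continuous_on {0..T} (\<lambda>t. X i t \<omega>)) \<and>
      (\<forall>i\<in>{1..N}. set_integrable lborel {0..T} (\<lambda>s. dyson_drift N (\<lambda>k. X k s \<omega>) i)) \<and>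
      (\<forall>i\<in>{1..N}. \<forall>s\<in>{0..T}. X i s \<omega> = sqrt (2 / \<beta>) * b i s \<omega>
                  + (LINT r:{0..s}|lborel. dyson_drift N (\<lambda>k. X k r \<omega>) i)) \<and>
      (AE s in lborel. 0 \<le> s \<longrightarrow> strict_mono_on {1..N} (\<lambda>i. X i s \<omega>))"
proof -
  note sol = sol[unfolded dyson_strong_solution_def]
  have "AE \<omega> in M. \<forall>i\<in>{1..N}. continuous_on {0..} (\<lambda>t. X i t \<omega>)"
    using sol by (intro AE_finite_allI) auto
  moreover have "AE \<omega> in M. \<forall>i\<in>{1..N}. X i 0 \<omega> = 0"
    using sol by (intro AE_finite_allI) auto
  moreover have "AE \<omega> in M. \<forall>i\<in>{1..N}. \<forall>t\<ge>0.
        set_integrable lborel {0..t} (\<lambda>s. dyson_drift N (\<lambda>k. X k s \<omega>) i) \<and>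
        X i t \<omega> = X i 0 \<omega> + sqrt (2 / \<beta>) * b i t \<omega>
                  + (LINT s:{0..t}|lborel. dyson_drift N (\<lambda>k. X k s \<omega>) i)"
    using sol by (intro AE_finite_allI) auto
  moreover have "AE \<omega> in M. \<forall>t\<ge>0. mono_on {1..N} (\<lambda>i. X i t \<omega>)"
    and "AE \<omega> in M. AE s in lborel. 0 \<le> s \<longrightarrow> inj_on (\<lambda>i. X i s \<omega>) {1..N}"
    using sol by auto
  ultimately show ?thesis
  proof eventually_elim
    case (elim \<omega>)
    have "AE s in lborel. 0 \<le> s \<longrightarrow> strict_mono_on {1..N} (\<lambda>i. X i s \<omega>)"
      using elim(5)
    proof eventually_elim
      case inj: (elim s)
      show ?case
      proof (intro impI strict_mono_onI)
        fix i j assume s: "0 \<le> s" and ij: "i \<in> {1..N}" "j \<in> {1..N}" "i < j"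
        have "X i s \<omega> \<le> X j s \<omega>"
          using mono_onD[OF elim(4)[rule_format, OF s] ij(1,2)] ij(3) by simp
        moreover have "X i s \<omega> \<noteq> X j s \<omega>"
          using inj s ij by (auto dest: inj_onD)
        ultimately show "X i s \<omega> < X j s \<omega>" by simp
      qed
    qed
    moreover have "continuous_on {0..T} (\<lambda>t. X i t \<omega>)" if "i \<in> {1..N}" for i
      using bspec[OF elim(1) that] by (rule continuous_on_subset) auto
    moreover have "set_integrable lborel {0..T} (\<lambda>s. dyson_drift N (\<lambda>k. X k s \<omega>) i)"
      if "i \<in> {1..N}" for i
      using elim(3) that T by blast
    moreover have "X i s \<omega> = sqrt (2 / \<beta>) * b i s \<omega>
        + (LINT r:{0..s}|lborel. dyson_drift N (\<lambda>k. X k r \<omega>) i)"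
      if "i \<in> {1..N}" "s \<in> {0..T}" for i s
      using bspec[OF elim(3) that(1)] bspec[OF elim(2) that(1)] that(2) by simp
    ultimately show ?case by blast
  qed
qed

text \<open>The common source of (1) and (2). \<open>G_restrict0\<close> says that only the
  particles \<open>1..N\<close> matter, the only coordinates for which the solution is known to be
  measurable and continuous.\<close>

theorem dyson_uniformly_vanishes_in_prob:
  fixes G :: "real \<Rightarrow> (nat \<Rightarrow> real) \<Rightarrow> real"
  assumes "prob_space M" and T: "0 < T" and bm: "independent_brownian_motions M N b"
    and sol: "\<And>\<beta>. \<beta> \<ge> 1 \<Longrightarrow> dyson_strong_solution M N b \<beta> (lam \<beta>)"
    and mono: "strict_mono_on {1..N} z" and z: "z ` {1..N} = {x. poly (hermite N) x = 0}"
    and G: "continuous_on ({0..T} \<times> UNIV) (\<lambda>(t, x). G t x)"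
    and G_restrict0: "\<And>t x. G t (restrict0 N x) = G t x"
    and G_zero: "\<And>t. t \<in> {0..T} \<Longrightarrow> G t (\<lambda>i. sqrt t * z i) = 0"
  shows "uniformly_vanishes_in_prob M T (\<lambda>\<beta> t \<omega>. G t (\<lambda>i. lam \<beta> i t \<omega>))"
proof -
  interpret M: prob_space M by fact
  interpret cM: prob_space "completion M" by (rule M.prob_space_completion)
  let ?X = "\<lambda>\<beta> t \<omega> i. lam \<beta> i t \<omega>"
  let ?S = "\<lambda>\<epsilon> \<beta>. {\<omega> \<in> space M. (SUP t\<in>{0..T}. ereal (G t (?X \<beta> t \<omega>))) \<ge> ereal \<epsilon>}"
  have b: "b i s \<in> borel_measurable M" if "i \<in> {1..N}" "0 \<le> s" for i s
    using bm that unfolding independent_brownian_motions_def std_brownian_motion_def by blast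
  have lam: "lam \<beta> i t \<in> borel_measurable (completion M)"
    if "1 \<le> \<beta>" "i \<in> {1..N}" "0 \<le> t" for \<beta> i t
  proof -
    have "lam \<beta> i t \<in> borel_measurable (brownian_filtration M N b t)"
      using sol[OF that(1)] that(2,3) unfolding dyson_strong_solution_def by blast
    then show ?thesis by (rule measurable_brownian_filtration_completion[OF _ b])
  qed
  have G_meas: "(\<lambda>\<omega>. G t (?X \<beta> t \<omega>)) \<in> borel_measurable (completion M)"
    if \<beta>: "1 \<le> \<beta>" and t: "t \<in> {0..T}" for \<beta> t
  proof -
    have "(\<lambda>\<omega>. restrict0 N (?X \<beta> t \<omega>)) \<in> borel_measurable (completion M)"
    proof (rule measurable_coordinatewise_then_product)
      show "(\<lambda>\<omega>. restrict0 N (?X \<beta> t \<omega>) i) \<in> borel_measurable (completion M)" for i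
        using lam[OF \<beta>, of i t] t by (cases "i \<in> {1..N}") (auto simp: restrict0_def)
    qed
    moreover have "continuous_on UNIV (G t)"
    proof -
      have "continuous_on UNIV (\<lambda>x. (\<lambda>(t, x). G t x) (t, x))"
        by (rule continuous_on_compose2[OF G]) (use t in \<open>auto intro!: continuous_intros\<close>)
      then show ?thesis by simp
    qed
    then have "G t \<in> borel_measurable borel" by (rule borel_measurable_continuous_onI)
    ultimately have "(\<lambda>\<omega>. G t (restrict0 N (?X \<beta> t \<omega>))) \<in> borel_measurable (completion M)"
      by (rule measurable_compose)
    then show ?thesis by (simp add: G_restrict0)
  qed
  have S_sets: "?S \<epsilon> \<beta> \<in> sets (completion M)" if \<beta>: "1 \<le> \<beta>" for \<epsilon> \<beta>
  proof (rule completion.in_sets_AE)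
    \<comment> \<open>The rational-time event agrees almost surely with the required one, and a
      complete measure space contains every set that agrees almost everywhere with a measurable
      set.\<close>
    let ?S' = "{\<omega> \<in> space M. (SUP t\<in>{0..T} \<inter> \<rat>. ereal (G t (?X \<beta> t \<omega>))) \<ge> ereal \<epsilon>}"
    have "AE \<omega> in M. \<omega> \<in> ?S' \<longleftrightarrow> \<omega> \<in> ?S \<epsilon> \<beta>"
      using dyson_strong_solution_paths[OF sol[OF \<beta>] less_imp_le[OF T]]
    proof eventually_elim
      case (elim \<omega>)
      have "continuous_on {0..T} (\<lambda>t. restrict0 N (?X \<beta> t \<omega>))"
        using elim by (intro continuous_on_restrict0) auto
      then have "continuous_on {0..T} (\<lambda>t. (\<lambda>(t, x). G t x) (t, restrict0 N (?X \<beta> t \<omega>)))"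
        by (intro continuous_on_compose2[OF G] continuous_on_Pair continuous_on_id) auto
      then have "continuous_on {0..T} (\<lambda>t. G t (?X \<beta> t \<omega>))" by (simp add: G_restrict0)
      from SUP_Icc_Int_Rats[OF T this] show ?case by simp
    qed
    then show "AE \<omega> in completion M. \<omega> \<in> ?S' \<longleftrightarrow> \<omega> \<in> ?S \<epsilon> \<beta>"
      by (rule AE_completion)
    have "(\<lambda>\<omega>. SUP t\<in>{0..T} \<inter> \<rat>. ereal (G t (?X \<beta> t \<omega>))) \<in> borel_measurable (completion M)"
      by (intro borel_measurable_SUP borel_measurable_ereal G_meas \<beta>)
         (auto intro: countable_Int2 countable_rat)
    from measurable_sets[OF this, of "{ereal \<epsilon>..}"] show "?S' \<in> sets (completion M)"
      by (simp add: vimage_def Int_def conj_commute)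
  qed auto
  have "((\<lambda>\<beta>. measure (completion M) (?S \<epsilon> \<beta>)) \<longlongrightarrow> 0) at_top" if "0 < \<epsilon>" for \<epsilon>
  proof (rule tendstoI)
    fix e :: real assume "0 < e"
    let ?y = "\<lambda>i t. sqrt t * z i"
    \<comment> \<open>Half of \<open>\<epsilon>\<close> is used because a supremum of values below
      \<open>\<epsilon>\<close> may equal \<open>\<epsilon>\<close>, which already belongs to the
      event.\<close>
    have "\<exists>\<eta>>0. \<forall>t\<in>{0..T}. \<forall>x. (\<forall>i\<in>{1..N}. \<bar>x i - ?y i t\<bar> < \<eta>) \<longrightarrow> G t (restrict0 N x) < \<epsilon> / 2"
      by (rule uniform_smallness_near_path[OF G])
         (use G_zero \<open>0 < \<epsilon>\<close> in \<open>auto simp: G_restrict0 intro!: continuous_intros\<close>)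
    then obtain \<eta> where "0 < \<eta>" and \<eta>: "\<And>t x. t \<in> {0..T} \<Longrightarrow>
        (\<And>i. i \<in> {1..N} \<Longrightarrow> \<bar>x i - ?y i t\<bar> < \<eta>) \<Longrightarrow> G t (restrict0 N x) < \<epsilon> / 2"
      by blast
    obtain \<delta> where "0 < \<delta>" and \<delta>: "\<And>x w t i.
      (\<forall>i\<in>{1..N}. set_integrable lborel {0..T} (\<lambda>s. dyson_drift N (\<lambda>k. x k s) i)) \<Longrightarrow>
      (\<forall>i\<in>{1..N}. \<forall>s\<in>{0..T}. x i s = w i s + (LINT r:{0..s}|lborel. dyson_drift N (\<lambda>k. x k r) i)) \<Longrightarrow>
      (AE s in lborel. 0 \<le> s \<longrightarrow> strict_mono_on {1..N} (\<lambda>i. x i s)) \<Longrightarrow>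
      (\<forall>i\<in>{1..N}. \<forall>s\<in>{0..T}. \<bar>w i s\<bar> \<le> \<delta>) \<Longrightarrow> t \<in> {0..T} \<Longrightarrow> i \<in> {1..N} \<Longrightarrow> \<bar>x i t - ?y i t\<bar> < \<eta>"
      using dyson_path_near_hermite_flow[OF mono z \<open>0 < \<eta>\<close>, of T] by blast
    obtain A n where A: "A \<in> sets M" "measure M A < e"
      and bound: "AE \<omega> in M. \<omega> \<notin> A \<longrightarrow> (\<forall>i\<in>{1..N}. \<forall>t\<in>{0..T}. \<bar>b i t \<omega>\<bar> \<le> real n)"
      using brownian_paths_bounded[OF \<open>prob_space M\<close> bm T \<open>0 < e\<close>] by blast
    have "((\<lambda>\<beta>. sqrt (2 / \<beta>) * real n) \<longlongrightarrow> sqrt 0 * real n) at_top"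
      by (intro tendsto_intros tendsto_divide_0[OF tendsto_const] filterlim_at_top_imp_at_infinity filterlim_ident)
    then have "\<forall>\<^sub>F \<beta> in at_top. sqrt (2 / \<beta>) * real n < \<delta>"
      using \<open>0 < \<delta>\<close> by (intro order_tendstoD(2)) auto
    then show "\<forall>\<^sub>F \<beta> in at_top. dist (measure (completion M) (?S \<epsilon> \<beta>)) 0 < e"
      using eventually_ge_at_top[of 1]
    proof eventually_elim
      case (elim \<beta>)
      \<comment> \<open>Outside \<open>A\<close>, which does not depend on \<open>\<beta>\<close>,
        the noise is at most \<open>sqrt (2 / \<beta>) * n < \<delta>\<close>, so the path stays
        close to the limit.\<close>
      have "AE \<omega> in M. \<omega> \<in> ?S \<epsilon> \<beta> \<longrightarrow> \<omega> \<in> A"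
        using dyson_strong_solution_paths[OF sol[OF elim(2)] less_imp_le[OF T]] bound
      proof eventually_elim
        case path: (elim \<omega>)
        show ?case
        proof (rule impI, rule ccontr)
          assume S: "\<omega> \<in> ?S \<epsilon> \<beta>" and "\<omega> \<notin> A"
          have "G t (?X \<beta> t \<omega>) \<le> \<epsilon> / 2" if t: "t \<in> {0..T}" for t
          proof -
            have "\<bar>lam \<beta> i t \<omega> - ?y i t\<bar> < \<eta>" if "i \<in> {1..N}" for i
            proof (rule \<delta>[of "\<lambda>i t. lam \<beta> i t \<omega>" "\<lambda>i t. sqrt (2 / \<beta>) * b i t \<omega>"])
              show "\<forall>i\<in>{1..N}. \<forall>s\<in>{0..T}. \<bar>sqrt (2 / \<beta>) * b i s \<omega>\<bar> \<le> \<delta>"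
              proof (intro ballI)
                fix i s assume "i \<in> {1..N}" "s \<in> {0..T}"
                then have "\<bar>b i s \<omega>\<bar> \<le> real n" using path \<open>\<omega> \<notin> A\<close> by blast
                then have "sqrt (2 / \<beta>) * \<bar>b i s \<omega>\<bar> \<le> sqrt (2 / \<beta>) * real n"
                  using elim by (intro mult_left_mono) auto
                moreover have "\<bar>sqrt (2 / \<beta>) * b i s \<omega>\<bar> = sqrt (2 / \<beta>) * \<bar>b i s \<omega>\<bar>"
                  using elim by (simp add: abs_mult)
                ultimately show "\<bar>sqrt (2 / \<beta>) * b i s \<omega>\<bar> \<le> \<delta>"
                  using elim(1) by linarith
              qed
            qed (use path t that in blast)+
            from \<eta>[OF t this] show ?thesis by (simp add: G_restrict0)
          qed
          then have "(SUP t\<in>{0..T}. ereal (G t (?X \<beta> t \<omega>))) \<le> ereal (\<epsilon> / 2)"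
            by (intro SUP_least) auto
          moreover have "ereal \<epsilon> \<le> (SUP t\<in>{0..T}. ereal (G t (?X \<beta> t \<omega>)))"
            using S by blast
          ultimately have "ereal \<epsilon> \<le> ereal (\<epsilon> / 2)" by (rule order.trans[rotated])
          then show False using \<open>0 < \<epsilon>\<close> by simp
        qed
      qed
      then have "measure (completion M) (?S \<epsilon> \<beta>) \<le> measure (completion M) A"
        using A(1) by (intro cM.finite_measure_mono_AE AE_completion) auto
      then show ?case using A by simp
    qed
  qed
  then show ?thesis
    using S_sets unfolding uniformly_vanishes_in_prob_def by blast
qed

section \<open>Empirical measures\<close>

lemma empirical_measure_restrict0: "empirical_measure N (restrict0 N x) = empirical_measure N x"
proof -
  have "(\<lambda>A. \<Sum>i=1..N. emeasure (return borel (restrict0 N x i)) A)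
      = (\<lambda>A. \<Sum>i=1..N. emeasure (return borel (x i)) A)"
    by (intro ext sum.cong) (auto simp: restrict0_def)
  then show ?thesis
    unfolding empirical_measure_def by metis
qed

text \<open>As the image of the uniform measure on the indices, coinciding particles are counted
  with multiplicity automatically, and integrals become finite averages.\<close>

lemma empirical_measure_eq_distr:
  assumes "0 < N"
  shows "empirical_measure N x = distr (uniform_count_measure {1..N}) borel x"
proof (rule measure_eqI)
  fix A assume "A \<in> sets (empirical_measure N x)"
  then have A: "A \<in> sets borel" by simp
  have "(\<Sum>i=1..N. emeasure (return borel (x i)) A) = of_nat (card {i \<in> {1..N}. x i \<in> A})"
    using A by (simp add: indicator_def sum.If_cases Int_def flip: of_nat_sum)
  then have "emeasure (empirical_measure N x) A = of_nat (card {i \<in> {1..N}. x i \<in> A}) / of_nat N"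
    using A by (simp add: emeasure_empirical_measure)
  also have "\<dots> = ennreal (real (card {i \<in> {1..N}. x i \<in> A}) / real N)"
    using assms by (simp add: divide_ennreal ennreal_of_nat_eq_real_of_nat)
  also have "\<dots> = emeasure (uniform_count_measure {1..N}) (x -` A \<inter> {1..N})"
    by (subst emeasure_uniform_count_measure) (auto simp: vimage_def Int_def conj_commute)
  also have "\<dots> = emeasure (distr (uniform_count_measure {1..N}) borel x) A"
    using A by (subst emeasure_distr) (auto simp: space_uniform_count_measure measurable_def sets_uniform_count_measure)
  finally show "emeasure (empirical_measure N x) A = \<dots>" .
qed simp

lemma integral_empirical_measure:
  fixes f :: "real \<Rightarrow> real"
  assumes "0 < N" and f: "f \<in> borel_measurable borel"
  shows "(\<integral>y. f y \<partial>empirical_measure N x) = (\<Sum>i=1..N. f (x i)) / real N"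
proof -
  have "x \<in> measurable (uniform_count_measure {1..N}) borel"
    by (auto simp: measurable_def sets_uniform_count_measure space_uniform_count_measure)
  then show ?thesis
    unfolding empirical_measure_eq_distr[OF assms(1)]
    by (simp add: integral_distr[OF _ f] integral_uniform_count_measure)
qed

lemma real_distribution_empirical_measure:
  assumes "0 < N"
  shows "real_distribution (empirical_measure N x)"
proof -
  interpret prob_space "uniform_count_measure {1..N}"
    using assms by (intro prob_space_uniform_count_measure) auto
  show ?thesis
    unfolding empirical_measure_eq_distr[OF assms]
    by (intro real_distribution_distr)
       (auto simp: measurable_def sets_uniform_count_measure space_uniform_count_measure)
qed

text \<open>A generating set of the weak topology pulls back to a condition on the average of the
  \<open>f (x i)\<close>, which is continuous in the configuration.\<close>

lemma continuous_map_empirical_measure: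
  assumes "0 < N"
  shows "continuous_map euclidean weak_topology (empirical_measure N)"
  unfolding weak_topology_def
proof (rule continuous_on_generated_topo)
  let ?S = "{{\<mu>. real_distribution \<mu> \<and> (\<integral>x. f x \<partial>\<mu>) \<in> U} | (f :: real \<Rightarrow> real) U.
        continuous_on UNIV f \<and> bounded (range f) \<and> open U}"
  fix V assume "V \<in> ?S"
  then obtain f :: "real \<Rightarrow> real" and U where V: "V = {\<mu>. real_distribution \<mu> \<and> (\<integral>x. f x \<partial>\<mu>) \<in> U}"
    and f: "continuous_on UNIV f" and U: "open U"
    by blast
  have "f \<in> borel_measurable borel" using f by (rule borel_measurable_continuous_onI)
  then have "empirical_measure N -` V = (\<lambda>x. (\<Sum>i=1..N. f (x i)) / real N) -` U"
    unfolding V using assms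
    by (auto simp: integral_empirical_measure real_distribution_empirical_measure)
  moreover have "continuous_on UNIV (\<lambda>x :: nat \<Rightarrow> real. (\<Sum>i=1..N. f (x i)) / real N)"
    using assms by (intro continuous_intros continuous_on_compose2[OF f] continuous_on_product_coordinates) auto
  then have "open ((\<lambda>x. (\<Sum>i=1..N. f (x i)) / real N) -` U)"
    using U by (simp add: open_vimage)
  ultimately show "openin euclidean (empirical_measure N -` V \<inter> topspace euclidean)"
    by simp
next
  \<comment> \<open>The carrier of the generated topology is the union of its generators; the test
    function 0 makes the set of all probability measures one of them.\<close>
  let ?U = "{\<mu>. real_distribution \<mu> \<and> (\<integral>x. 0 \<partial>\<mu>) \<in> (UNIV :: real set)}"
  have "empirical_measure N ` topspace euclidean \<subseteq> ?U"
    using real_distribution_empirical_measure[OF assms] by auto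
  also have "?U \<subseteq> \<Union> {{\<mu>. real_distribution \<mu> \<and> (\<integral>x. f x \<partial>\<mu>) \<in> U} | (f :: real \<Rightarrow> real) U.
        continuous_on UNIV f \<and> bounded (range f) \<and> open U}"
    by (rule Union_upper) (auto intro!: exI[of _ "\<lambda>_. 0 :: real"] exI[of _ UNIV])
  finally show "empirical_measure N ` topspace euclidean \<subseteq> \<dots>" .
qed

section \<open>The evolution equation of the limit\<close>

text \<open>\<open>F\<close> is the primitive of a function continuous up to 0, and such a primitive
  is differentiable at the end point too, from the right.\<close>

lemma has_real_derivative_at_left_endpoint:
  fixes F F' :: "real \<Rightarrow> real"
  assumes F: "continuous_on {0..} F" and F': "continuous_on {0..} F'"
    and deriv: "\<And>s. 0 < s \<Longrightarrow> (F has_real_derivative F' s) (at s)" and t: "0 \<le> t"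
  shows "(F has_real_derivative F' t) (at t within {0..})"
proof -
  let ?b = "t + 1"
  have F'b: "continuous_on {0..?b} F'" using F' by (rule continuous_on_subset) auto
  have F_eq: "F s = F 0 + integral {0..s} F'" if "s \<in> {0..?b}" for s
  proof -
    have "(F' has_integral F s - F 0) {0..s}"
      using that F deriv
      by (intro fundamental_theorem_of_calculus_interior)
         (auto simp: has_real_derivative_iff_has_vector_derivative[symmetric] intro: continuous_on_subset)
    then show ?thesis by (simp add: integral_unique)
  qed
  have "((\<lambda>s. integral {0..s} F') has_real_derivative F' t) (at t within {0..?b})"
    using F'b t by (intro integral_has_real_derivative) auto
  then have "((\<lambda>s. F 0 + integral {0..s} F') has_real_derivative F' t) (at t within {0..?b})"
    by (auto intro!: derivative_eq_intros)
  then have "(F has_real_derivative F' t) (at t within {0..?b})"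
    by (rule has_field_derivative_transform_within[where d = 1]) (use t in \<open>auto simp: F_eq[symmetric]\<close>)
  moreover have "at t within {0..?b} = at t within {0..}"
    by (rule at_within_nhd[of _ "{..<?b}"]) auto
  ultimately show ?thesis by simp
qed

lemma continuous_on_polynomial_function2:
  assumes "polynomial_function2 f"
  shows "continuous_on UNIV (\<lambda>(t, x). f t x)"
proof -
  obtain n c where "\<And>t x. f t x = (\<Sum>i\<le>n. \<Sum>j\<le>n. c i j * t ^ i * x ^ j)"
    using assms unfolding polynomial_function2_def by blast
  then show ?thesis
    by (auto simp: case_prod_unfold intro!: continuous_intros)
qed

lemma polynomial_function2_measurable:
  assumes "polynomial_function2 f"
  shows "f t \<in> borel_measurable borel"
proof -
  have "continuous_on UNIV (\<lambda>x. (\<lambda>(t, x). f t x) (t, x))"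
    by (intro continuous_on_compose2[OF continuous_on_polynomial_function2[OF assms]] continuous_intros) auto
  then show ?thesis
    by (intro borel_measurable_continuous_onI) simp
qed

locale polynomial2 =
  fixes n :: nat and c :: "nat \<Rightarrow> nat \<Rightarrow> real" and f
  assumes f_eq: "\<And>t x. f t x = (\<Sum>i\<le>n. \<Sum>j\<le>n. c i j * t ^ i * x ^ j)"
begin

text \<open>The truncated exponents \<open>j - 1\<close> here and in the companions below are
  harmless: whenever truncation occurs, a factor 0 accompanies it.\<close>

definition "f_x t x = (\<Sum>i\<le>n. \<Sum>j\<le>n. c i j * t ^ i * (real j * x ^ (j - 1)))"
definition "f_xx t x = (\<Sum>i\<le>n. \<Sum>j\<le>n. c i j * t ^ i * (real j * (real (j - 1) * x ^ (j - 1 - 1))))"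
definition "f_t t x = (\<Sum>i\<le>n. \<Sum>j\<le>n. c i j * (real i * t ^ (i - 1)) * x ^ j)"
text \<open>The divided difference of \<open>f_x\<close> written as a polynomial, so that continuity
  on the diagonal is immediate; at time 0 all pairs of particles lie there.\<close>

definition "quot t x y =
  (\<Sum>i\<le>n. \<Sum>j\<le>n. c i j * t ^ i * (real j * (\<Sum>k<j - 1. y ^ (j - 1 - Suc k) * x ^ k)))"

lemma deriv_x: "deriv (f t) = f_x t"
proof
  have "(f t has_real_derivative f_x t x) (at x)" for x
    unfolding f_eq[abs_def] f_x_def by (auto intro!: derivative_eq_intros sum.cong)
  then show "deriv (f t) x = f_x t x" for x by (rule DERIV_imp_deriv)
qed

lemma deriv_xx: "deriv (f_x t) = f_xx t"
proof
  have "(f_x t has_real_derivative f_xx t x) (at x)" for x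
    unfolding f_x_def[abs_def] f_xx_def by (auto intro!: derivative_eq_intros sum.cong)
  then show "deriv (f_x t) x = f_xx t x" for x by (rule DERIV_imp_deriv)
qed

lemma deriv_t: "deriv (\<lambda>s. f s x) t = f_t t x"
proof (rule DERIV_imp_deriv)
  show "((\<lambda>s. f s x) has_real_derivative f_t t x) (at t)"
    unfolding f_eq f_t_def by (auto intro!: derivative_eq_intros sum.cong)
qed

lemma f_x_diff: "f_x t x - f_x t y = (x - y) * quot t x y"
  by (simp add: f_x_def quot_def sum_distrib_left power_diff_sumr2
      flip: sum_subtractf right_diff_distrib) (simp add: mult_ac sum_distrib_left)

lemma quot_diag: "quot t x x = f_xx t x"
proof -
  have "(\<Sum>k<j - 1. x ^ (j - 1 - Suc k) * x ^ k) = real (j - 1) * x ^ (j - 1 - 1)" for j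
    by (simp add: numeral_2_eq_2 flip: power_add)
  then show ?thesis by (simp add: quot_def f_xx_def)
qed

lemma deriv_quotient_eq: "deriv_quotient f t x y = quot t x y"
  by (simp add: deriv_quotient_def deriv_x deriv_xx f_x_diff quot_diag)

lemma continuous_on_partials:
  fixes g h :: "'b :: topological_space \<Rightarrow> real"
  assumes "continuous_on S g" "continuous_on S h"
  shows continuous_on_f: "continuous_on S (\<lambda>s. f (g s) (h s))"
    and continuous_on_f_xx: "continuous_on S (\<lambda>s. f_xx (g s) (h s))"
    and continuous_on_f_t: "continuous_on S (\<lambda>s. f_t (g s) (h s))"
  unfolding f_eq f_xx_def f_t_def by (intro continuous_intros assms)+

lemma continuous_on_quot:
  fixes g h k :: "'b :: topological_space \<Rightarrow> real"
  assumes "continuous_on S g" "continuous_on S h" "continuous_on S k"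
  shows "continuous_on S (\<lambda>s. quot (g s) (h s) (k s))"
  unfolding quot_def by (intro continuous_intros assms)

lemma has_real_derivative_along_sqrt:
  assumes "0 < t"
  shows "((\<lambda>s. f s (sqrt s * a)) has_real_derivative
           f_t t (sqrt t * a) + f_x t (sqrt t * a) * (a / (2 * sqrt t))) (at t)"
proof -
  have d: "((\<lambda>s. sqrt s * a) has_real_derivative a / (2 * sqrt t)) (at t)"
    using assms by (auto intro!: derivative_eq_intros simp: divide_simps)
  have "((\<lambda>s. f s (sqrt s * a)) has_real_derivative
      (\<Sum>i\<le>n. \<Sum>j\<le>n. c i j * (real i * t ^ (i - 1)) * (sqrt t * a) ^ j
        + c i j * t ^ i * (real j * (sqrt t * a) ^ (j - 1)) * (a / (2 * sqrt t)))) (at t)"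
    unfolding f_eq
    by (intro DERIV_sum DERIV_cong[OF DERIV_mult[OF DERIV_cmult[OF DERIV_pow] DERIV_power[OF d]]])
       (simp add: mult_ac)
  then show ?thesis
    by (simp only: f_t_def f_x_def sum.distrib sum_distrib_right)
qed

text \<open>Symmetrised, the drift sum contains only off-diagonal divided differences, whereas the
  double integral in (3) also counts \<open>i = j\<close>. Removing these diagonal terms is the
  origin of \<open>- (1 / 2) * f''\<close>.\<close>

lemma sum_f_x_dyson_drift:
  "(\<Sum>i=1..N. f_x t (y i) * dyson_drift N y i)
    = ((\<Sum>i=1..N. \<Sum>j=1..N. quot t (y i) (y j)) - (\<Sum>i=1..N. f_xx t (y i))) / 2"
  if inj: "inj_on y {1..N}"
proof -
  have "(f_x t (y i) - f_x t (y j)) / (y i - y j) = quot t (y i) (y j) - (if i = j then f_xx t (y i) else 0)"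
    if "i \<in> {1..N}" "j \<in> {1..N}" for i j
    using inj that by (auto simp: f_x_diff quot_diag dest: inj_onD)
  then show ?thesis
    unfolding sum_dyson_drift by (simp add: sum_subtractf)
qed

text \<open>At \<open>t = 0\<close> the particles coincide and the computation breaks down; the claim there follows from
  the continuity of both sides.\<close>

lemma hermite_flow_derivative:
  fixes z :: "nat \<Rightarrow> real"
  assumes N: "0 < N" and inj: "inj_on z {1..N}" and z: "z ` {1..N} = {x. poly (hermite N) x = 0}"
    and \<mu>: "\<And>t. \<mu> t = empirical_measure N (\<lambda>i. sqrt t * z i)" and t: "0 \<le> t"
  shows "((\<lambda>s. \<integral>x. f s x \<partial>\<mu> s) has_real_derivative
           real N / 2 * (\<integral>x. (\<integral>y. deriv_quotient f t x y \<partial>\<mu> t) \<partial>\<mu> t)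
           + (\<integral>x. - (1 / 2) * deriv (deriv (f t)) x + deriv (\<lambda>s. f s x) t \<partial>\<mu> t))
          (at t within {0..})"
proof -
  define y where "y = (\<lambda>t i. sqrt t * z i)"
  define F where "F = (\<lambda>s. (\<Sum>i=1..N. f s (y s i)) / real N)"
  \<comment> \<open>The claimed derivative as finite sums: the factor \<open>N / 2\<close> times the
    two averages \<open>1 / N\<close> becomes \<open>1 / (2 * N)\<close>.\<close>
  define R where "R = (\<lambda>s. (\<Sum>i=1..N. \<Sum>j=1..N. quot s (y s i) (y s j)) / (2 * real N)
      + (\<Sum>i=1..N. - (1 / 2) * f_xx s (y s i) + f_t s (y s i)) / real N)"
  have F: "(\<integral>x. f s x \<partial>\<mu> s) = F s" for s
    unfolding \<mu> F_def y_def
    by (intro integral_empirical_measure[OF N] borel_measurable_continuous_onI continuous_on_f continuous_intros)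
  have "(\<integral>x. (\<integral>y. deriv_quotient f t x y \<partial>\<mu> t) \<partial>\<mu> t)
      = (\<integral>x. (\<Sum>j=1..N. quot t x (y t j)) / real N \<partial>\<mu> t)"
    unfolding deriv_quotient_eq \<mu> y_def
    by (intro arg_cong[where f = "integral\<^sup>L _"] ext integral_empirical_measure[OF N]
        borel_measurable_continuous_onI continuous_on_quot continuous_intros)
  also have "\<dots> = (\<Sum>i=1..N. (\<Sum>j=1..N. quot t (y t i) (y t j)) / real N) / real N"
    unfolding \<mu> y_def using N
    by (intro integral_empirical_measure[OF N] borel_measurable_continuous_onI continuous_on_quot continuous_intros) auto
  finally have I1: "real N / 2 * (\<integral>x. (\<integral>y. deriv_quotient f t x y \<partial>\<mu> t) \<partial>\<mu> t)
      = (\<Sum>i=1..N. \<Sum>j=1..N. quot t (y t i) (y t j)) / (2 * real N)"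
    using N by (simp flip: sum_divide_distrib)
  have I2: "(\<integral>x. - (1 / 2) * deriv (deriv (f t)) x + deriv (\<lambda>s. f s x) t \<partial>\<mu> t)
      = (\<Sum>i=1..N. - (1 / 2) * f_xx t (y t i) + f_t t (y t i)) / real N"
    unfolding deriv_x deriv_xx deriv_t \<mu> y_def
    by (intro integral_empirical_measure[OF N] borel_measurable_continuous_onI continuous_on_f_xx
        continuous_on_f_t continuous_intros)
  have "(F has_real_derivative R t) (at t within {0..})"
  proof (rule has_real_derivative_at_left_endpoint)
    show "continuous_on {0..} F"
      unfolding F_def y_def using N by (intro continuous_intros continuous_on_f) auto
    show "continuous_on {0..} R"
      unfolding R_def y_def using N
      by (intro continuous_intros continuous_on_f_xx continuous_on_f_t continuous_on_quot) auto
    fix s :: real assume s: "0 < s"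
    have inj_y: "inj_on (y s) {1..N}"
      using inj s by (intro inj_onI) (auto simp: y_def dest: inj_onD)
    have drift: "dyson_drift N (y s) i = z i / (2 * sqrt s)" if "i \<in> {1..N}" for i
      unfolding y_def dyson_drift_scale dyson_drift_hermite_zeros[OF inj z that] by simp
    have "(F has_real_derivative
        (\<Sum>i=1..N. f_t s (y s i) + f_x s (y s i) * (z i / (2 * sqrt s))) / real N) (at s)"
      unfolding F_def y_def
      by (intro DERIV_cdivide DERIV_sum has_real_derivative_along_sqrt s)
    also have "(\<Sum>i=1..N. f_t s (y s i) + f_x s (y s i) * (z i / (2 * sqrt s)))
        = (\<Sum>i=1..N. f_t s (y s i)) + (\<Sum>i=1..N. f_x s (y s i) * dyson_drift N (y s) i)"
      by (simp add: drift sum.distrib)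
    also have "\<dots> / real N = R s"
      unfolding R_def sum_f_x_dyson_drift[OF inj_y] sum.distrib sum_distrib_left[symmetric]
      using N by (simp add: field_simps)
    finally show "(F has_real_derivative R s) (at s)" .
  qed (rule t)
  then show ?thesis
    unfolding F I1 I2 R_def .
qed

end

theorem theorem4p1:
  fixes M :: "'a measure" and N :: nat and T :: real
    and b :: "nat \<Rightarrow> real \<Rightarrow> 'a \<Rightarrow> real"
    and lam :: "real \<Rightarrow> nat \<Rightarrow> real \<Rightarrow> 'a \<Rightarrow> real"
    and z :: "nat \<Rightarrow> real"
    and \<mu>\<beta> :: "real \<Rightarrow> real \<Rightarrow> 'a \<Rightarrow> real measure"
    and \<mu> :: "real \<Rightarrow> real measure"
  assumes "prob_space M" and "N \<ge> 2" and "T > 0"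
    and "independent_brownian_motions M N b"
    and "\<And>\<beta>. \<beta> \<ge> 1 \<Longrightarrow> dyson_strong_solution M N b \<beta> (lam \<beta>)"
    and "strict_mono_on {1..N} z" and "z ` {1..N} = {x. poly (hermite N) x = 0}"
    and "\<And>\<beta> t \<omega>. \<mu>\<beta> \<beta> t \<omega> = empirical_measure N (\<lambda>i. lam \<beta> i t \<omega>)"
    and "\<And>t. \<mu> t = empirical_measure N (\<lambda>i. sqrt t * z i)"
  shows
    "(\<forall>m. mtopology_of m = weak_topology \<longrightarrow>
        uniformly_vanishes_in_prob M T (\<lambda>\<beta> t \<omega>. mdist m (\<mu>\<beta> \<beta> t \<omega>) (\<mu> t)))
   \<and> (\<forall>f. polynomial_function2 f \<longrightarrow>
        uniformly_vanishes_in_prob M T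
          (\<lambda>\<beta> t \<omega>. \<bar>(\<integral>x. f t x \<partial>\<mu>\<beta> \<beta> t \<omega>) - (\<integral>x. f t x \<partial>\<mu> t)\<bar>))
   \<and> (\<forall>f. polynomial_function2 f \<longrightarrow> (\<forall>t\<ge>0.
        ((\<lambda>s. \<integral>x. f s x \<partial>\<mu> s) has_real_derivative
           real N / 2 * (\<integral>x. (\<integral>y. deriv_quotient f t x y \<partial>\<mu> t) \<partial>\<mu> t)
           + (\<integral>x. - (1 / 2) * deriv (deriv (f t)) x + deriv (\<lambda>s. f s x) t \<partial>\<mu> t))
          (at t within {0..})))"
proof (intro conjI allI impI)
  note vanishes = dyson_uniformly_vanishes_in_prob[OF assms(1,3,4,5,6,7)]
  have N: "0 < N" using \<open>N \<ge> 2\<close> by simp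
  {
    fix m :: "real measure metric"
    assume m: "mtopology_of m = weak_topology"
    have emp: "continuous_map euclidean (mtopology_of m) (empirical_measure N)"
      unfolding m by (rule continuous_map_empirical_measure[OF N])
    have compose: "continuous_map euclidean (mtopology_of m) (\<lambda>p. empirical_measure N (g p))"
      if "continuous_on UNIV g" for g :: "real \<times> (nat \<Rightarrow> real) \<Rightarrow> nat \<Rightarrow> real"
      using continuous_map_compose[OF _ emp, of euclidean g] that by (simp add: o_def)
    have "continuous_map euclidean euclidean
        (\<lambda>p. mdist m (empirical_measure N (snd p)) (empirical_measure N (\<lambda>i. sqrt (fst p) * z i)))"
      by (intro continuous_map_mdist compose)
         (auto intro!: continuous_intros continuous_on_product_then_coordinatewise[OF continuous_on_snd])
    then have "continuous_on ({0..T} \<times> UNIV) (\<lambda>(t, x).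
        mdist m (empirical_measure N x) (empirical_measure N (\<lambda>i. sqrt t * z i)))"
      by (auto simp: case_prod_unfold intro: continuous_on_subset)
    \<comment> \<open>Needed for \<open>G_zero\<close>: the distance of a point to itself is known
      to be 0 only inside the carrier of \<open>m\<close>.\<close>
    moreover have "empirical_measure N x \<in> mspace m" for x
      using emp by (auto simp: continuous_map_def)
    ultimately show "uniformly_vanishes_in_prob M T (\<lambda>\<beta> t \<omega>. mdist m (\<mu>\<beta> \<beta> t \<omega>) (\<mu> t))"
      unfolding assms(8,9)
      by (intro vanishes[where G = "\<lambda>t x. mdist m (empirical_measure N x)
            (empirical_measure N (\<lambda>i. sqrt t * z i))"])
         (simp_all add: empirical_measure_restrict0)
  next
    fix f :: "real \<Rightarrow> real \<Rightarrow> real"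
    assume f: "polynomial_function2 f"
    have eq: "(\<integral>y. f t y \<partial>empirical_measure N x) = (\<Sum>i=1..N. f t (x i)) / real N" for t x
      by (intro integral_empirical_measure[OF N] polynomial_function2_measurable f)
    have cont: "continuous_on S (\<lambda>p. f (g p) (h p))"
      if "continuous_on S g" "continuous_on S h" for S and g h :: "real \<times> (nat \<Rightarrow> real) \<Rightarrow> real"
      using continuous_on_compose2[OF continuous_on_polynomial_function2[OF f], of S "\<lambda>p. (g p, h p)"] that
      by (simp add: continuous_on_Pair)
    have snd: "continuous_on S (\<lambda>p. snd p i)" for S and i :: nat
      by (rule continuous_on_product_then_coordinatewise[OF continuous_on_snd[OF continuous_on_id]])
    show "uniformly_vanishes_in_prob M T
          (\<lambda>\<beta> t \<omega>. \<bar>(\<integral>x. f t x \<partial>\<mu>\<beta> \<beta> t \<omega>) - (\<integral>x. f t x \<partial>\<mu> t)\<bar>)"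
      unfolding assms(8,9) eq
    proof (rule vanishes)
      show "continuous_on ({0..T} \<times> UNIV) (\<lambda>(t, x).
          \<bar>(\<Sum>i=1..N. f t (x i)) / real N - (\<Sum>i=1..N. f t (sqrt t * z i)) / real N\<bar>)"
        unfolding case_prod_unfold using N by (intro continuous_intros cont snd) auto
    qed (auto simp: restrict0_def)
  next
    fix f :: "real \<Rightarrow> real \<Rightarrow> real" and t :: real
    assume "polynomial_function2 f" and "0 \<le> t"
    then obtain n c where "polynomial2 n c f"
      unfolding polynomial_function2_def polynomial2_def by blast
    then show "((\<lambda>s. \<integral>x. f s x \<partial>\<mu> s) has_real_derivative
           real N / 2 * (\<integral>x. (\<integral>y. deriv_quotient f t x y \<partial>\<mu> t) \<partial>\<mu> t)
           + (\<integral>x. - (1 / 2) * deriv (deriv (f t)) x + deriv (\<lambda>s. f s x) t \<partial>\<mu> t))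
          (at t within {0..})"
      using N strict_mono_on_imp_inj_on[OF assms(6)] assms(7,9) \<open>0 \<le> t\<close>
      by (rule polynomial2.hermite_flow_derivative)
  }
qed

end
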